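(* Let $G=(V,E)$ be a graph that is rigid in $\mathbb{R}^d$, let $xy\in E$ be an $\mathcal{R}_d$-bridge in $G$ with $\deg_G(y)\ge d+2$, and suppose that the vertices in $N_G(y)\setminus\{x\}$ are pairwise globally $d$-linked in $G-y$. Let $\{u,v\}$ be a pair of vertices with $y\notin\{u,v\}$ such that $\{u,v\}$ is not globally $d$-linked in $G-y$. Then $\{u,v\}$ is not globally $d$-linked in $G$.
   Context: A framework $(G,p)$ in $\mathbb{R}^d$ is a map $p:V\to\mathbb{R}^d$; it is generic if its coordinates are algebraically independent over $\mathbb{Q}$. $(G,p)$ and $(G,q)$ are equivalent if $\|p(a)-p(b)\|=\|q(a)-q(b)\|$ for all edges $ab$, congruent if this holds for all pairs of vertices. $(G,p)$ is rigid if there is $\varepsilon>0$ such that every equivalent $(G,q)$ with $\|p(w)-q(w)\|<\varepsilon$ for all $w$ is congruent to $(G,p)$; a graph is rigid in $\mathbb{R}^d$ ($d$-rigid) if its generic realizations in $\mathbb{R}^d$ are rigid. A pair $\{u,v\}$ is globally linked in $(G,p)$ if every equivalent $(G,q)$ in $\mathbb{R}^d$ has $\|q(u)-q(v)\|=\|p(u)-p(v)\|$, and globally $d$-linked in $G$ if it is globally linked in every generic realization of $G$ in $\mathbb{R}^d$. The rigidity matroid $\mathcal{R}_d(G)$ is the linear matroid on $E$ of the rows of the rigidity matrix of a generic realization (row of edge $ab$: $p(a)-p(b)$ in the columns of $a$, $p(b)-p(a)$ in those of $b$), with rank $r_d$; an edge $e$ is an $\mathcal{R}_d$-bridge in $G$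 if $r_d(G-e)=r_d(G)-1$. $N_G(y)$ is the set of neighbours of $y$. *)

theory Defs
  imports "HOL-Analysis.Analysis" "HOL-Library.Poly_Mapping"
begin

text \<open>
  A graph is given by a vertex set \<open>V\<close> and a set \<open>E\<close> of two-element subsets of \<open>V\<close>. The vertex
  type will be of class \<^class>\<open>finite\<close>, but \<open>V\<close> is an arbitrary subset of it, so that
  vertex-deleted subgraphs live over the same type.
\<close>

definition simple_graph :: "'v set \<Rightarrow> 'v set set \<Rightarrow> bool" where
  "simple_graph V E \<longleftrightarrow> finite V \<and> (\<forall>e\<in>E. e \<subseteq> V \<and> card e = 2)"

definition neighbours :: "'v set set \<Rightarrow> 'v \<Rightarrow> 'v set" where
  "neighbours E y = {w. {y, w} \<in> E}"

definition vertex_degree :: "'v set set \<Rightarrow> 'v \<Rightarrow> nat" where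
  "vertex_degree E y = card {e\<in>E. y \<in> e}"

definition edges_avoiding :: "'v set set \<Rightarrow> 'v \<Rightarrow> 'v set set" where
  "edges_avoiding E y = {e\<in>E. y \<notin> e}"

text \<open>
  A polynomial over the rationals in indeterminates \<open>X\<^sub>i\<close> (\<open>i :: 'i\<close>) is a finitely supported map
  from monomials to coefficients, and a monomial is a finitely supported map from indeterminates
  to exponents.
\<close>

definition eval_rat_poly :: "('i \<Rightarrow> real) \<Rightarrow> (('i \<Rightarrow>\<^sub>0 nat) \<Rightarrow>\<^sub>0 rat) \<Rightarrow> real" where
  "eval_rat_poly x P =
     (\<Sum>m\<in>Poly_Mapping.keys P. of_rat (Poly_Mapping.lookup P m) *
        (\<Prod>i\<in>Poly_Mapping.keys m. x i ^ Poly_Mapping.lookup m i))"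

definition alg_independent_over_rat :: "'i set \<Rightarrow> ('i \<Rightarrow> real) \<Rightarrow> bool" where
  "alg_independent_over_rat I x \<longleftrightarrow>
     (\<forall>P :: ('i \<Rightarrow>\<^sub>0 nat) \<Rightarrow>\<^sub>0 rat.
        (\<forall>m\<in>Poly_Mapping.keys P. Poly_Mapping.keys m \<subseteq> I) \<and> eval_rat_poly x P = 0 \<longrightarrow> P = 0)"

text \<open>
  A realization is a total function on the vertex type; only its values on \<open>V\<close> matter in the
  notions below.
\<close>

definition generic :: "'v set \<Rightarrow> ('v \<Rightarrow> real^'d) \<Rightarrow> bool" where
  "generic V p \<longleftrightarrow> alg_independent_over_rat (V \<times> (UNIV :: 'd set)) (\<lambda>(w, i). p w $ i)"

definition equivalent_frameworks ::
    "'v set set \<Rightarrow> ('v \<Rightarrow> real^'d) \<Rightarrow> ('v \<Rightarrow> real^'d) \<Rightarrow> bool" where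
  "equivalent_frameworks E p q \<longleftrightarrow>
     (\<forall>a b. {a, b} \<in> E \<longrightarrow> norm (p a - p b) = norm (q a - q b))"

definition congruent_frameworks ::
    "'v set \<Rightarrow> ('v \<Rightarrow> real^'d) \<Rightarrow> ('v \<Rightarrow> real^'d) \<Rightarrow> bool" where
  "congruent_frameworks V p q \<longleftrightarrow>
     (\<forall>a\<in>V. \<forall>b\<in>V. norm (p a - p b) = norm (q a - q b))"

definition rigid_framework :: "'v set \<Rightarrow> 'v set set \<Rightarrow> ('v \<Rightarrow> real^'d) \<Rightarrow> bool" where
  "rigid_framework V E p \<longleftrightarrow>
     (\<exists>\<epsilon>>0. \<forall>q. equivalent_frameworks E p q \<and> (\<forall>w\<in>V. norm (p w - q w) < \<epsilon>)
        \<longrightarrow> congruent_frameworks V p q)"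

definition globally_linked_in_framework ::
    "'v set set \<Rightarrow> ('v \<Rightarrow> real^'d) \<Rightarrow> 'v \<Rightarrow> 'v \<Rightarrow> bool" where
  "globally_linked_in_framework E p u v \<longleftrightarrow>
     (\<forall>q. equivalent_frameworks E p q \<longrightarrow> norm (q u - q v) = norm (p u - p v))"

text \<open>
  The dimension is \<open>CARD('d)\<close>, passed through the type argument \<open>TYPE('d)\<close>.
\<close>

definition rigid_graph :: "'d::finite itself \<Rightarrow> 'v set \<Rightarrow> 'v set set \<Rightarrow> bool" where
  "rigid_graph _ V E \<longleftrightarrow> (\<forall>p :: 'v \<Rightarrow> real^'d. generic V p \<longrightarrow> rigid_framework V E p)"

definition globally_linked ::
    "'d::finite itself \<Rightarrow> 'v set \<Rightarrow> 'v set set \<Rightarrow> 'v \<Rightarrow> 'v \<Rightarrow> bool" where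
  "globally_linked _ V E u v \<longleftrightarrow>
     (\<forall>p :: 'v \<Rightarrow> real^'d. generic V p \<longrightarrow> globally_linked_in_framework E p u v)"

text \<open>
  The columns of the rigidity matrix are grouped by vertex, so a row is a vector in
  \<open>real^'d^'v\<close>; columns of vertices outside \<open>V\<close> are zero and do not affect the rank. The row is
  symmetric in the two end vertices.
\<close>

definition rigidity_row :: "('v::finite \<Rightarrow> real^'d) \<Rightarrow> 'v \<Rightarrow> 'v \<Rightarrow> real^'d^'v" where
  "rigidity_row p a b =
     (\<chi> w. if w = a then p a - p b else if w = b then p b - p a else 0)"

definition rigidity_rows :: "'v::finite set set \<Rightarrow> ('v \<Rightarrow> real^'d) \<Rightarrow> (real^'d^'v) set" where
  "rigidity_rows E p = {rigidity_row p a b | a b. {a, b} \<in> E}"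

text \<open>
  The rank \<open>r\<^sub>d(G)\<close> is computed in some generic realization; as usual, the matroid does not depend
  on which one is chosen.
\<close>

definition rigidity_rank :: "'d::finite itself \<Rightarrow> 'v::finite set \<Rightarrow> 'v set set \<Rightarrow> nat" where
  "rigidity_rank _ V E = dim (rigidity_rows E (SOME p :: 'v \<Rightarrow> real^'d. generic V p))"

text \<open>
  The equation \<open>r\<^sub>d(G - e) = r\<^sub>d(G) - 1\<close> is written without truncated subtraction.
\<close>

definition rigidity_bridge ::
    "'d::finite itself \<Rightarrow> 'v::finite set \<Rightarrow> 'v set set \<Rightarrow> 'v set \<Rightarrow> bool" where
  "rigidity_bridge d V E e \<longleftrightarrow>
     e \<in> E \<and> rigidity_rank d V (E - {e}) + 1 = rigidity_rank d V E"

end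

theory Submission
  imports Defs "HOL-Computational_Algebra.Polynomial"
begin

text \<open>
  Let \<open>p\<close> be generic and \<open>q\<close> equivalent to \<open>p\<close> on \<open>G - y\<close> with a different distance of \<open>u\<close>
  and \<open>v\<close>. Since squared edge lengths that are independent at a generic point are algebraically
  independent, and real numbers are algebraically independent exactly if they can be given
  arbitrary images under derivations, the rows of a basis of the rigidity matroid remain linearly
  independent at \<open>q\<close>. So the realizations near \<open>q\<close> that are equivalent to \<open>p\<close> form a connected
  manifold \<open>S\<close>, which contains generic points.

  All of \<open>S\<close> induces the same distances on the neighbours of \<open>y\<close> other than \<open>x\<close>. If \<open>x\<close> did not
  move relative to these along \<open>S\<close>, then the row of \<open>xy\<close> would be a combination of the
  other rows and \<open>xy\<close> would not be a bridge. Hence, after moving the neighbours back to their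
  places in \<open>p\<close>, the point \<open>x\<close> has nonconstant positions \<open>s\<^sub>x\<close> (\<open>s \<in> S\<close>), and the bisecting
  hyperplanes of \<open>p(x)\<close> and \<open>s\<^sub>x\<close> sweep out an open set. Placing \<open>y\<close> generically in this set
  gives a generic realization of \<open>G\<close>, and some \<open>s \<in> S\<close> extends to a realization equivalent to it.
\<close>

section \<open>Rational polynomials and algebraic independence\<close>

text \<open>The obstacle is that \<open>q\<close> need not be generic: all that it is known to share
  with \<open>p\<close> is the edge lengths. Algebraic independence concerns these numbers alone,
  which is why it, and not a rank, is carried from \<open>p\<close> to \<open>q\<close>. Derivations
  turn it back into linear algebra, since by the chain rule a derivation acts on a length as a
  vector paired with a gradient. They may take any real values, and only finitely many numbers are
  adjoined, so neither fraction fields nor maximal extensions occur. The set \<open>S\<close>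
  prescribes only the lengths of a basis. Every other edge length is algebraic over these, so it
  takes finitely many values on \<open>S\<close>, and connectedness makes it constant. The sweep of
  the bisectors is reduced to a sign change: \<open>y\<close> is put where two positions of
  \<open>x\<close> give opposite signs, and the intermediate value theorem on \<open>S\<close>
  supplies the required third one. No isometry moving the neighbours back is constructed;
  barycentric coordinates with respect to \<open>d + 1\<close> neighbours replace it. These are to
  differ from \<open>x\<close>, whence the degree \<open>d + 2\<close>.\<close>

abbreviation lookup where "lookup \<equiv> Poly_Mapping.lookup"
abbreviation keys where "keys \<equiv> Poly_Mapping.keys"
abbreviation single where "single \<equiv> Poly_Mapping.single"

definition mon_eval :: "('i \<Rightarrow> real) \<Rightarrow> ('i \<Rightarrow>\<^sub>0 nat) \<Rightarrow> real" where
  "mon_eval x m = (\<Prod>i\<in>keys m. x i ^ lookup m i)"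

lemma mon_eval_superset:
  assumes "finite S" "keys m \<subseteq> S"
  shows "mon_eval x m = (\<Prod>i\<in>S. x i ^ lookup m i)"
  unfolding mon_eval_def using assms
  by (intro prod.mono_neutral_left) (auto simp: in_keys_iff)

lemma mon_eval_add: "mon_eval x (m + n) = mon_eval x m * mon_eval x n"
proof -
  let ?S = "keys m \<union> keys n"
  have "mon_eval x (m + n) = (\<Prod>i\<in>?S. x i ^ lookup (m + n) i)"
    by (rule mon_eval_superset) (use keys_add[of m n] in auto)
  also have "\<dots> = mon_eval x m * mon_eval x n"
    by (simp add: lookup_add power_add prod.distrib mon_eval_superset[of ?S])
  finally show ?thesis .
qed

lemma mon_eval_0 [simp]: "mon_eval x 0 = 1"
  by (simp add: mon_eval_def)

lemma mon_eval_single [simp]: "mon_eval x (single i k) = x i ^ k"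
  by (simp add: mon_eval_def)

lemma eval_rat_poly_superset:
  assumes "finite S" "keys P \<subseteq> S"
  shows "eval_rat_poly x P = (\<Sum>m\<in>S. of_rat (lookup P m) * mon_eval x m)"
  unfolding eval_rat_poly_def mon_eval_def using assms
  by (intro sum.mono_neutral_left) (auto simp: in_keys_iff)

lemma eval_rat_poly_0 [simp]: "eval_rat_poly x 0 = 0"
  by (simp add: eval_rat_poly_def)

lemma eval_rat_poly_single [simp]:
  "eval_rat_poly x (single m c) = of_rat c * mon_eval x m"
  by (simp add: eval_rat_poly_superset[of "{m}"])

lemma eval_rat_poly_add:
  "eval_rat_poly x (P + Q) = eval_rat_poly x P + eval_rat_poly x Q"
proof -
  let ?S = "keys P \<union> keys Q"
  have "eval_rat_poly x (P + Q) = (\<Sum>m\<in>?S. of_rat (lookup (P + Q) m) * mon_eval x m)"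
    by (rule eval_rat_poly_superset) (use keys_add[of P Q] in auto)
  then show ?thesis
    by (simp add: lookup_add of_rat_add ring_distribs sum.distrib eval_rat_poly_superset[of ?S])
qed

lemma eval_rat_poly_sum:
  "eval_rat_poly x (\<Sum>a\<in>A. f a) = (\<Sum>a\<in>A. eval_rat_poly x (f a))"
  by (induction A rule: infinite_finite_induct) (auto simp: eval_rat_poly_add)

lemma poly_mapping_as_sum:
  "(P :: 'a \<Rightarrow>\<^sub>0 'b::comm_monoid_add) = (\<Sum>m\<in>keys P. single m (lookup P m))"
proof (rule poly_mapping_eqI)
  fix k
  have "lookup (\<Sum>m\<in>keys P. single m (lookup P m)) k
      = (\<Sum>m\<in>keys P. if m = k then lookup P m else 0)"
    by (simp add: lookup_sum lookup_single when_def)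
  also have "\<dots> = lookup P k"
    by (simp add: in_keys_iff)
  finally show "lookup P k = lookup (\<Sum>m\<in>keys P. single m (lookup P m)) k" by simp
qed

lemma eval_rat_poly_mult:
  "eval_rat_poly x (P * Q) = eval_rat_poly x P * eval_rat_poly x Q"
proof -
  have "P * Q = (\<Sum>m\<in>keys P. \<Sum>n\<in>keys Q. single m (lookup P m) * single n (lookup Q n))"
    by (subst poly_mapping_as_sum[of P], subst poly_mapping_as_sum[of Q])
       (simp only: sum_distrib_left sum_distrib_right, rule sum.swap)
  also have "eval_rat_poly x \<dots> = (\<Sum>m\<in>keys P. \<Sum>n\<in>keys Q.
      (of_rat (lookup P m) * mon_eval x m) * (of_rat (lookup Q n) * mon_eval x n))"
    by (simp add: eval_rat_poly_sum mult_single of_rat_mult mon_eval_add mult_ac)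
  also have "\<dots> = eval_rat_poly x P * eval_rat_poly x Q"
    by (simp add: eval_rat_poly_def mon_eval_def sum_product)
  finally show ?thesis .
qed

lemma eval_rat_poly_cong:
  assumes "\<And>m. m \<in> keys P \<Longrightarrow> keys m \<subseteq> I" "\<And>i. i \<in> I \<Longrightarrow> x i = y i"
  shows "eval_rat_poly x P = eval_rat_poly y P"
  unfolding eval_rat_poly_def using assms
  by (intro sum.cong prod.cong refl arg_cong2[where f="(*)"]) force

definition ratpolys :: "'i set \<Rightarrow> (('i \<Rightarrow>\<^sub>0 nat) \<Rightarrow>\<^sub>0 rat) set" where
  "ratpolys I = {P. \<forall>m\<in>keys P. keys m \<subseteq> I}"

lemma ratpolys_single: "keys m \<subseteq> I \<Longrightarrow> single m c \<in> ratpolys I"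
  by (auto simp: ratpolys_def)

lemma ratpolys_0: "0 \<in> ratpolys I"
  by (auto simp: ratpolys_def)

lemma ratpolys_add: "P \<in> ratpolys I \<Longrightarrow> Q \<in> ratpolys I \<Longrightarrow> P + Q \<in> ratpolys I"
  unfolding ratpolys_def using keys_add[of P Q] by blast

lemma ratpolys_mult: "P \<in> ratpolys I \<Longrightarrow> Q \<in> ratpolys I \<Longrightarrow> P * Q \<in> ratpolys I"
proof -
  assume PQ: "P \<in> ratpolys I" "Q \<in> ratpolys I"
  have "keys m \<subseteq> I" if "m \<in> keys (P * Q)" for m
  proof -
    obtain a b where "m = a + b" "a \<in> keys P" "b \<in> keys Q"
      using keys_mult[of P Q] \<open>m \<in> keys (P * Q)\<close> by blast
    with PQ show ?thesis
      using keys_add[of a b] unfolding ratpolys_def by blast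
  qed
  then show ?thesis by (simp add: ratpolys_def)
qed

lemma ratpolys_sum: "(\<And>a. a \<in> A \<Longrightarrow> f a \<in> ratpolys I) \<Longrightarrow> (\<Sum>a\<in>A. f a) \<in> ratpolys I"
  by (induction A rule: infinite_finite_induct) (auto simp: ratpolys_0 ratpolys_add)

lemma alg_independent_iff:
  "alg_independent_over_rat I x \<longleftrightarrow> (\<forall>P\<in>ratpolys I. eval_rat_poly x P = 0 \<longrightarrow> P = 0)"
  by (auto simp: alg_independent_over_rat_def ratpolys_def)

lemma alg_independent_mono:
  "alg_independent_over_rat J x \<Longrightarrow> I \<subseteq> J \<Longrightarrow> alg_independent_over_rat I x"
  unfolding alg_independent_over_rat_def by blast

lemma alg_independent_cong:
  assumes "\<And>i. i \<in> I \<Longrightarrow> x i = y i"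
  shows "alg_independent_over_rat I x \<longleftrightarrow> alg_independent_over_rat I y"
proof -
  have "eval_rat_poly x P = eval_rat_poly y P" if "P \<in> ratpolys I" for P
    by (rule eval_rat_poly_cong[where I=I]) (use that assms in \<open>auto simp: ratpolys_def\<close>)
  then show ?thesis by (simp add: alg_independent_iff)
qed

text \<open>\<open>P\<close> is read as a univariate polynomial in the indeterminate
  \<open>i\<close>: \<open>R k\<close> collects the monomials with exponent \<open>k\<close> at
  \<open>i\<close>, stripped of \<open>i\<close>.\<close>

lemma ratpoly_split:
  assumes "P \<in> ratpolys (insert i I)"
  shows "\<exists>R. (\<forall>k::nat. R k \<in> ratpolys I) \<and> finite {k. R k \<noteq> 0} \<and>
    (\<forall>x. eval_rat_poly x P = (\<Sum>k | R k \<noteq> 0. eval_rat_poly x (R k) * x i ^ k)) \<and>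
    (P \<noteq> 0 \<longrightarrow> (\<exists>k. R k \<noteq> 0))"
proof -
  define rem where "rem m = Poly_Mapping.update i 0 m" for m :: "'a \<Rightarrow>\<^sub>0 nat"
  define R where "R k = (\<Sum>m | m \<in> keys P \<and> lookup m i = k. single (rem m) (lookup P m))" for k
  have split: "m = rem m + single i (lookup m i)" for m
    by (rule poly_mapping_eqI) (simp add: rem_def lookup_add lookup_update lookup_single when_def)
  have keys_rem: "keys (rem m) \<subseteq> keys m - {i}" for m
    by (auto simp: rem_def in_keys_iff lookup_update split: if_splits)
  have 1: "R k \<in> ratpolys I" for k
    unfolding R_def
  proof (intro ratpolys_sum ratpolys_single)
    fix m assume "m \<in> {m. m \<in> keys P \<and> lookup m i = k}"
    then show "keys (rem m) \<subseteq> I"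
      using assms keys_rem[of m] by (auto simp: ratpolys_def)
  qed
  have sub: "{k. R k \<noteq> 0} \<subseteq> (\<lambda>m. lookup m i) ` keys P"
  proof
    fix k assume "k \<in> {k. R k \<noteq> 0}"
    then have "{m. m \<in> keys P \<and> lookup m i = k} \<noteq> {}"
      by (simp add: R_def) (auto elim!: sum.not_neutral_contains_not_neutral)
    then show "k \<in> (\<lambda>m. lookup m i) ` keys P" by auto
  qed
  then have 2: "finite {k. R k \<noteq> 0}"
    by (rule finite_subset) auto
  have 3: "eval_rat_poly x P = (\<Sum>k | R k \<noteq> 0. eval_rat_poly x (R k) * x i ^ k)" for x
  proof -
    have m: "mon_eval x m = mon_eval x (rem m) * x i ^ lookup m i" for m
      by (subst split[of m]) (simp add: mon_eval_add)
    have "eval_rat_poly x P = (\<Sum>m\<in>keys P. of_rat (lookup P m) * mon_eval x m)"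
      by (simp add: eval_rat_poly_superset)
    also have "\<dots> = (\<Sum>k\<in>(\<lambda>m. lookup m i) ` keys P.
        \<Sum>m | m \<in> keys P \<and> lookup m i = k. of_rat (lookup P m) * mon_eval x m)"
      by (rule sum.image_gen) simp
    also have "\<dots> = (\<Sum>k\<in>(\<lambda>m. lookup m i) ` keys P. eval_rat_poly x (R k) * x i ^ k)"
      unfolding R_def eval_rat_poly_sum sum_distrib_right
      by (intro sum.cong refl) (simp, subst m, simp)
    also have "\<dots> = (\<Sum>k | R k \<noteq> 0. eval_rat_poly x (R k) * x i ^ k)"
      by (rule sum.mono_neutral_right) (use sub in auto)
    finally show ?thesis .
  qed
  have 4: "\<exists>k. R k \<noteq> 0" if "P \<noteq> 0"
  proof -
    have "keys P \<noteq> {}"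
      using that poly_mapping_as_sum[of P] by auto
    then obtain m where m: "m \<in> keys P" by blast
    \<comment> \<open>A monomial is recovered from its exponent at \<open>i\<close> and the rest, so
      nothing cancels inside \<open>R k\<close>.\<close>
    have inj: "rem n = rem m \<longleftrightarrow> n = m" if "lookup n i = lookup m i" for n
    proof
      assume "rem n = rem m"
      then show "n = m" by (subst split[of n], subst split[of m]) (simp add: that)
    qed simp
    have "lookup (R (lookup m i)) (rem m)
        = (\<Sum>n | n \<in> keys P \<and> lookup n i = lookup m i. if n = m then lookup P n else 0)"
      unfolding R_def lookup_sum by (rule sum.cong) (auto simp: lookup_single when_def inj)
    also have "\<dots> = lookup P m"
      using m by (simp add: sum.delta)
    finally have "R (lookup m i) \<noteq> 0"
      using m by (auto simp: in_keys_iff)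
    then show ?thesis ..
  qed
  show ?thesis
    by (rule exI[of _ R]) (use 1 2 3 4 in simp)
qed

text \<open>The subring of the reals generated over the rationals by the numbers \<open>x i\<close>
  with \<open>i \<in> I\<close>.\<close>

definition ratring :: "'i set \<Rightarrow> ('i \<Rightarrow> real) \<Rightarrow> real set" where
  "ratring I x = eval_rat_poly x ` ratpolys I"

lemma ratring_rat: "of_rat c \<in> ratring I x"
  unfolding ratring_def by (rule image_eqI[of _ _ "single 0 c"]) (auto intro: ratpolys_single)

lemma ratring_gen: "i \<in> I \<Longrightarrow> x i \<in> ratring I x"
  unfolding ratring_def
  by (rule image_eqI[of _ _ "single (single i 1) 1"]) (auto intro: ratpolys_single)

lemma ratring_add: "a \<in> ratring I x \<Longrightarrow> b \<in> ratring I x \<Longrightarrow> a + b \<in> ratring I x"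
  unfolding ratring_def by (auto simp flip: eval_rat_poly_add intro: ratpolys_add)

lemma ratring_mult: "a \<in> ratring I x \<Longrightarrow> b \<in> ratring I x \<Longrightarrow> a * b \<in> ratring I x"
  unfolding ratring_def by (auto simp flip: eval_rat_poly_mult intro: ratpolys_mult)

definition subring_over_rat :: "real set \<Rightarrow> bool" where
  "subring_over_rat A \<longleftrightarrow> (\<forall>c. of_rat c \<in> A) \<and> (\<forall>a\<in>A. \<forall>b\<in>A. a + b \<in> A \<and> a * b \<in> A)"

lemma subring_over_ratD:
  assumes "subring_over_rat A"
  shows "of_rat c \<in> A" "a \<in> A \<Longrightarrow> b \<in> A \<Longrightarrow> a + b \<in> A" "a \<in> A \<Longrightarrow> b \<in> A \<Longrightarrow> a * b \<in> A"
    "0 \<in> A" "1 \<in> A" "a \<in> A \<Longrightarrow> - a \<in> A" "a \<in> A \<Longrightarrow> b \<in> A \<Longrightarrow> a - b \<in> A"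
    "a \<in> A \<Longrightarrow> a ^ n \<in> A" "of_nat n \<in> A"
proof -
  show *: "of_rat c \<in> A" "a \<in> A \<Longrightarrow> b \<in> A \<Longrightarrow> a + b \<in> A" "a \<in> A \<Longrightarrow> b \<in> A \<Longrightarrow> a * b \<in> A"
    for a b c using assms by (auto simp: subring_over_rat_def)
  show "0 \<in> A" "1 \<in> A" using *(1)[of 0] *(1)[of 1] by auto
  show neg: "a \<in> A \<Longrightarrow> - a \<in> A" for a
    using *(3)[of "of_rat (-1)" a] *(1)[of "-1"] by (simp add: of_rat_minus)
  show "a \<in> A \<Longrightarrow> b \<in> A \<Longrightarrow> a - b \<in> A"
    using *(2)[of a "- b"] neg by simp
  show "a \<in> A \<Longrightarrow> a ^ n \<in> A"
    by (induction n) (use * \<open>1 \<in> A\<close> in auto)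
  show "of_nat n \<in> A"
    by (induction n) (use * \<open>1 \<in> A\<close> \<open>0 \<in> A\<close> in auto)
qed

lemma subring_sum: "subring_over_rat A \<Longrightarrow> (\<And>s. s \<in> S \<Longrightarrow> f s \<in> A) \<Longrightarrow> (\<Sum>s\<in>S. f s) \<in> A"
  by (induction S rule: infinite_finite_induct) (auto simp: subring_over_ratD)

lemma subring_prod: "subring_over_rat A \<Longrightarrow> (\<And>s. s \<in> S \<Longrightarrow> f s \<in> A) \<Longrightarrow> (\<Prod>s\<in>S. f s) \<in> A"
  by (induction S rule: infinite_finite_induct) (auto simp: subring_over_ratD)

lemma subring_ratring: "subring_over_rat (ratring I x)"
  by (auto simp: subring_over_rat_def ratring_rat ratring_add ratring_mult)

lemma ratring_least:
  assumes "subring_over_rat A" "\<And>i. i \<in> I \<Longrightarrow> x i \<in> A"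
  shows "ratring I x \<subseteq> A"
proof
  fix r assume "r \<in> ratring I x"
  then obtain P where "P \<in> ratpolys I" and r: "r = eval_rat_poly x P"
    by (auto simp: ratring_def)
  then show "r \<in> A"
    unfolding r eval_rat_poly_def using assms
    by (intro subring_sum subring_over_ratD(3) subring_prod subring_over_ratD(1) subring_over_ratD(8))
       (auto simp: ratpolys_def)
qed

lemma ratring_mono: "I \<subseteq> J \<Longrightarrow> ratring I x \<subseteq> ratring J x"
  by (intro ratring_least subring_ratring) (auto intro: ratring_gen)

section \<open>Polynomials over a subring and transcendental numbers\<close>

definition polys_over :: "real set \<Rightarrow> real poly set" where
  "polys_over A = {P. \<forall>k. coeff P k \<in> A}"

lemma polys_over_mono: "A \<subseteq> B \<Longrightarrow> polys_over A \<subseteq> polys_over B"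
  by (auto simp: polys_over_def)

definition transcendental_over :: "real set \<Rightarrow> real \<Rightarrow> bool" where
  "transcendental_over A t \<longleftrightarrow> (\<forall>P\<in>polys_over A. poly P t = 0 \<longrightarrow> P = 0)"

lemma poly_in_subring:
  "subring_over_rat A \<Longrightarrow> P \<in> polys_over A \<Longrightarrow> t \<in> A \<Longrightarrow> poly P t \<in> A"
  unfolding poly_altdef by (intro subring_sum) (auto simp: subring_over_ratD polys_over_def)

lemma polys_over_closed:
  assumes "subring_over_rat A"
  shows "P \<in> polys_over A \<Longrightarrow> Q \<in> polys_over A \<Longrightarrow> P + Q \<in> polys_over A"
    "P \<in> polys_over A \<Longrightarrow> Q \<in> polys_over A \<Longrightarrow> P - Q \<in> polys_over A"
    "P \<in> polys_over A \<Longrightarrow> Q \<in> polys_over A \<Longrightarrow> P * Q \<in> polys_over A"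
    "P \<in> polys_over A \<Longrightarrow> pderiv P \<in> polys_over A"
    "a \<in> A \<Longrightarrow> monom a n \<in> polys_over A"
    "a \<in> A \<Longrightarrow> P \<in> polys_over A \<Longrightarrow> smult a P \<in> polys_over A"
    "a \<in> A \<Longrightarrow> P \<in> polys_over A \<Longrightarrow> pCons a P \<in> polys_over A"
proof -
  note A = subring_over_ratD[OF assms]
  show "P \<in> polys_over A \<Longrightarrow> Q \<in> polys_over A \<Longrightarrow> P + Q \<in> polys_over A"
    by (simp add: polys_over_def A(2))
  show "P \<in> polys_over A \<Longrightarrow> Q \<in> polys_over A \<Longrightarrow> P - Q \<in> polys_over A"
    by (simp add: polys_over_def A(7))
  show "a \<in> A \<Longrightarrow> monom a n \<in> polys_over A"
    by (simp add: polys_over_def A(4))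
  show "a \<in> A \<Longrightarrow> P \<in> polys_over A \<Longrightarrow> smult a P \<in> polys_over A"
    by (simp add: polys_over_def A(3))
  show "a \<in> A \<Longrightarrow> P \<in> polys_over A \<Longrightarrow> pCons a P \<in> polys_over A"
    unfolding polys_over_def by (simp add: coeff_pCons split: nat.split)
  show "P \<in> polys_over A \<Longrightarrow> Q \<in> polys_over A \<Longrightarrow> P * Q \<in> polys_over A"
    unfolding polys_over_def coeff_mult mem_Collect_eq
    by (intro allI subring_sum[OF assms] A(3)) blast+
  show "P \<in> polys_over A \<Longrightarrow> pderiv P \<in> polys_over A"
  proof -
    assume P: "P \<in> polys_over A"
    have "of_nat (Suc k) * coeff P (Suc k) \<in> A" for k
      by (rule A(3), rule A(9)) (use P in \<open>simp add: polys_over_def\<close>)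
    then show ?thesis unfolding polys_over_def mem_Collect_eq coeff_pderiv by blast
  qed
qed

lemma polys_over_pConsD:
  assumes "pCons a P \<in> polys_over A" shows "a \<in> A" "P \<in> polys_over A"
  using assms by (auto simp: polys_over_def coeff_pCons split: nat.splits)

lemma transcendental_if_alg_independent_insert:
  assumes "alg_independent_over_rat (insert i I) x" "i \<notin> I"
  shows "transcendental_over (ratring I x) (x i)"
  unfolding transcendental_over_def
proof (intro ballI impI)
  fix P assume P: "P \<in> polys_over (ratring I x)" and 0: "poly P (x i) = 0"
  have "\<forall>k. \<exists>R\<in>ratpolys I. coeff P k = eval_rat_poly x R"
    using P by (auto simp: polys_over_def ratring_def)
  then obtain R where R: "\<And>k. R k \<in> ratpolys I" "\<And>k. coeff P k = eval_rat_poly x (R k)"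
    by metis
  define M where "M = (\<Sum>k\<le>degree P. R k * single (single i k) 1)"
  have M: "M \<in> ratpolys (insert i I)"
    unfolding M_def
  proof (intro ratpolys_sum ratpolys_mult)
    show "R k \<in> ratpolys (insert i I)" for k
      using R(1)[of k] by (auto simp: ratpolys_def)
    show "single (single i k) 1 \<in> ratpolys (insert i I)" for k
      by (rule ratpolys_single) auto
  qed
  \<comment> \<open>The value at \<open>i\<close> is replaced by an arbitrary \<open>t\<close>, so
    that \<open>M = 0\<close> makes \<open>poly P\<close> vanish everywhere;
    \<open>i \<notin> I\<close> keeps the coefficients unchanged.\<close>
  have eval: "eval_rat_poly (x(i := t)) M = poly P t" for t
  proof -
    have "eval_rat_poly (x(i := t)) (R k) = coeff P k" for k
      unfolding R(2) by (rule eval_rat_poly_cong[where I=I])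
        (use R(1)[of k] assms(2) in \<open>auto simp: ratpolys_def\<close>)
    then show ?thesis
      by (simp add: M_def eval_rat_poly_sum eval_rat_poly_mult poly_altdef)
  qed
  have "M = 0"
    using assms(1) M eval[of "x i"] 0 by (simp add: alg_independent_iff)
  then have "\<forall>t. poly P t = 0"
    using eval by (metis eval_rat_poly_0)
  then show "P = 0"
    by (rule poly_all_0_iff_0[THEN iffD1])
qed

text \<open>Sorting a relation by powers of \<open>x i\<close> gives a univariate polynomial over
  \<open>ratring I x\<close>. Transcendence kills its coefficients as numbers, independence on
  \<open>I\<close> then kills them as polynomials.\<close>

lemma alg_independent_insertI:
  assumes I: "alg_independent_over_rat I x" and t: "transcendental_over (ratring I x) (x i)"
  shows "alg_independent_over_rat (insert i I) x"
  unfolding alg_independent_iff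
proof (intro ballI impI)
  fix P assume P: "P \<in> ratpolys (insert i I)" and 0: "eval_rat_poly x P = 0"
  obtain R where "(\<forall>k::nat. R k \<in> ratpolys I) \<and> finite {k. R k \<noteq> 0} \<and>
    (\<forall>x. eval_rat_poly x P = (\<Sum>k | R k \<noteq> 0. eval_rat_poly x (R k) * x i ^ k)) \<and>
    (P \<noteq> 0 \<longrightarrow> (\<exists>k. R k \<noteq> 0))"
    using ratpoly_split[OF P] ..
  then have R: "\<And>k. R k \<in> ratpolys I" "finite {k. R k \<noteq> 0}"
    "\<And>x. eval_rat_poly x P = (\<Sum>k | R k \<noteq> 0. eval_rat_poly x (R k) * x i ^ k)"
    "P \<noteq> 0 \<Longrightarrow> \<exists>k. R k \<noteq> 0"
    by auto
  define U where "U = (\<Sum>k | R k \<noteq> 0. monom (eval_rat_poly x (R k)) k)"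
  have coeff: "coeff U k = eval_rat_poly x (R k)" for k
    using R(2) by (simp add: U_def coeff_sum)
  have "U \<in> polys_over (ratring I x)"
    using R(1) by (auto simp: polys_over_def coeff ratring_def)
  moreover have "poly U (x i) = 0"
    using 0 R(3)[of x] by (simp add: U_def poly_sum poly_monom)
  ultimately have "U = 0"
    using t by (simp add: transcendental_over_def)
  then have "R k = 0" for k
    using coeff[of k] R(1)[of k] I by (simp add: alg_independent_iff)
  then show "P = 0" using R(4) by metis
qed

lemma alg_independent_empty: "alg_independent_over_rat {} x"
  unfolding alg_independent_iff
proof (intro ballI impI)
  fix P :: "('a \<Rightarrow>\<^sub>0 nat) \<Rightarrow>\<^sub>0 rat"
  assume "P \<in> ratpolys {}" and 0: "eval_rat_poly x P = 0"
  then have "keys P \<subseteq> {0}" by (auto simp: ratpolys_def)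
  moreover from this have "lookup P 0 = 0"
    using 0 eval_rat_poly_superset[of "{0}" P x] by simp
  ultimately show "P = 0"
    by (intro poly_mapping_eqI) (metis in_keys_iff lookup_zero singletonD subsetD)
qed

section \<open>Derivations of subrings of the reals\<close>

text \<open>The values of \<open>D\<close> lie in the reals and not necessarily in \<open>A\<close>,
  so the image of an algebraic element may involve a division although \<open>A\<close> is only a
  ring.\<close>

definition derivation_on :: "real set \<Rightarrow> (real \<Rightarrow> real) \<Rightarrow> bool" where
  "derivation_on A D \<longleftrightarrow> subring_over_rat A \<and> (\<forall>c. D (of_rat c) = 0) \<and>
     (\<forall>a\<in>A. \<forall>b\<in>A. D (a + b) = D a + D b \<and> D (a * b) = D a * b + a * D b)"

lemma derivation_onD:
  assumes "derivation_on A D"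
  shows "subring_over_rat A" "D (of_rat c) = 0" "D 0 = 0" "D 1 = 0"
    "a \<in> A \<Longrightarrow> b \<in> A \<Longrightarrow> D (a + b) = D a + D b"
    "a \<in> A \<Longrightarrow> b \<in> A \<Longrightarrow> D (a * b) = D a * b + a * D b"
    "a \<in> A \<Longrightarrow> b \<in> A \<Longrightarrow> D (a - b) = D a - D b"
proof -
  have r: "D (of_rat c) = 0" for c
    using assms by (auto simp: derivation_on_def)
  show A: "subring_over_rat A" and "D (of_rat c) = 0"
    using assms by (auto simp: derivation_on_def)
  show "D 0 = 0" "D 1 = 0" using r[of 0] r[of 1] by auto
  show add: "D (a + b) = D a + D b" if "a \<in> A" "b \<in> A" for a b
    using assms that by (auto simp: derivation_on_def)
  show "a \<in> A \<Longrightarrow> b \<in> A \<Longrightarrow> D (a * b) = D a * b + a * D b"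
    using assms by (auto simp: derivation_on_def)
  show "D (a - b) = D a - D b" if "a \<in> A" "b \<in> A"
    using add[of "a - b" b] that subring_over_ratD(7)[OF A] by simp
qed

text \<open>For a derivation \<open>D\<close> of the coefficient ring, this is the value that the prescription
  \<open>t \<mapsto> c\<close> forces on \<open>P(t)\<close>.\<close>

definition formal_deriv :: "(real \<Rightarrow> real) \<Rightarrow> real \<Rightarrow> real \<Rightarrow> real poly \<Rightarrow> real" where
  "formal_deriv D t c P = poly (map_poly D P) t + poly (pderiv P) t * c"

lemma formal_deriv_pCons:
  assumes "D 0 = 0"
  shows "formal_deriv D t c (pCons a P) = D a + poly P t * c + t * formal_deriv D t c P"
  using assms by (simp add: formal_deriv_def map_poly_pCons pderiv_pCons algebra_simps)

lemma formal_deriv_0 [simp]: "formal_deriv D t c 0 = 0"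
  by (simp add: formal_deriv_def)

context
  fixes A D assumes D: "derivation_on A D"
begin

lemmas derivation_subring = derivation_onD(1)[OF D]

lemma formal_deriv_add:
  "P \<in> polys_over A \<Longrightarrow> Q \<in> polys_over A \<Longrightarrow>
    formal_deriv D t c (P + Q) = formal_deriv D t c P + formal_deriv D t c Q"
proof (induction P Q rule: poly_induct2)
  case (pCons a P b Q)
  note P = polys_over_pConsD[OF pCons.prems(1)] and Q = polys_over_pConsD[OF pCons.prems(2)]
  have IH: "formal_deriv D t c (P + Q) = formal_deriv D t c P + formal_deriv D t c Q"
    by (rule pCons.IH[OF P(2) Q(2)])
  show ?case
    by (simp add: formal_deriv_pCons derivation_onD[OF D] P Q IH ring_distribs)
qed simp

lemma formal_deriv_smult:
  "a \<in> A \<Longrightarrow> P \<in> polys_over A \<Longrightarrow>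
    formal_deriv D t c (smult a P) = D a * poly P t + a * formal_deriv D t c P"
proof (induction P)
  case (pCons b P)
  note P = polys_over_pConsD[OF pCons.prems(2)]
  have IH: "formal_deriv D t c (smult a P) = D a * poly P t + a * formal_deriv D t c P"
    by (rule pCons.IH[OF pCons.prems(1) P(2)])
  show ?case
    by (simp add: formal_deriv_pCons derivation_onD[OF D] P pCons.prems(1) IH algebra_simps)
qed simp

lemma formal_deriv_mult:
  "P \<in> polys_over A \<Longrightarrow> Q \<in> polys_over A \<Longrightarrow>
    formal_deriv D t c (P * Q) = formal_deriv D t c P * poly Q t + poly P t * formal_deriv D t c Q"
proof (induction P)
  case (pCons a P)
  note P = polys_over_pConsD[OF pCons.prems(1)] and Q = pCons.prems(2)
  note cl = polys_over_closed[OF derivation_subring]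
  have IH: "formal_deriv D t c (P * Q)
      = formal_deriv D t c P * poly Q t + poly P t * formal_deriv D t c Q"
    by (rule pCons.IH[OF P(2) Q])
  have "formal_deriv D t c (pCons a P * Q)
      = formal_deriv D t c (smult a Q) + formal_deriv D t c (pCons 0 (P * Q))"
    unfolding mult_pCons_left
    by (rule formal_deriv_add) (use P Q cl(3,6,7) subring_over_ratD(4)[OF derivation_subring] in blast)+
  then show ?case
    by (simp add: formal_deriv_smult formal_deriv_pCons derivation_onD[OF D] P Q IH algebra_simps)
qed simp

text \<open>Once \<open>t\<close> lies in the ring, the product rule leaves no choice for the value;
  applied to an annihilating polynomial this yields an equation for its derivative at
  \<open>t\<close>.\<close>

lemma derivation_poly:
  assumes "P \<in> polys_over A" "t \<in> A"
  shows "D (poly P t) = formal_deriv D t (D t) P"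
  using assms(1)
proof (induction P)
  case 0
  then show ?case by (simp add: derivation_onD[OF D])
next
  case (pCons a P)
  note P = polys_over_pConsD[OF pCons.prems]
  have IH: "D (poly P t) = formal_deriv D t (D t) P"
    by (rule pCons.IH[OF P(2)])
  have m: "poly P t \<in> A" by (rule poly_in_subring[OF derivation_subring P(2) assms(2)])
  show ?case
    by (simp add: formal_deriv_pCons derivation_onD[OF D] P m assms(2) IH
        subring_over_ratD(3)[OF derivation_subring])
qed

text \<open>\<open>key\<close> is well-definedness: two polynomials over \<open>A\<close> with the
  same value at \<open>t\<close> differ by a relation, whose formal derivative vanishes. The sum and
  product rules are inherited from \<open>formal_deriv\<close>.\<close>

lemma derivation_extend_by:
  assumes key: "\<And>P. P \<in> polys_over A \<Longrightarrow> poly P t = 0 \<Longrightarrow> formal_deriv D t c P = 0"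
  shows "\<exists>A' D'. derivation_on A' D' \<and> A' = (\<lambda>P. poly P t) ` polys_over A \<and> A \<subseteq> A' \<and> t \<in> A' \<and>
    (\<forall>a\<in>A. D' a = D a) \<and> D' t = c"
proof -
  note cl = polys_over_closed[OF derivation_subring]
  define A' where "A' = (\<lambda>P. poly P t) ` polys_over A"
  define D' where "D' r = formal_deriv D t c (SOME P. P \<in> polys_over A \<and> poly P t = r)" for r
  have D': "D' (poly P t) = formal_deriv D t c P" if P: "P \<in> polys_over A" for P
  proof -
    define Q where "Q = (SOME Q. Q \<in> polys_over A \<and> poly Q t = poly P t)"
    have Q: "Q \<in> polys_over A \<and> poly Q t = poly P t"
      unfolding Q_def by (rule someI[of _ P]) (use P in simp)
    have "formal_deriv D t c (P - Q) = 0"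
      by (rule key) (use P Q cl(2) in auto)
    moreover have "formal_deriv D t c P = formal_deriv D t c (P - Q) + formal_deriv D t c Q"
      by (subst formal_deriv_add[symmetric]) (use P Q cl(2) in auto)
    ultimately show ?thesis by (simp add: D'_def Q_def)
  qed
  have const: "[:a:] \<in> polys_over A" if "a \<in> A" for a
    using cl(5)[OF that, of 0] by (simp add: monom_0)
  have X: "[:0, 1:] \<in> polys_over A"
    using cl(5)[of 1 1] subring_over_ratD(5)[OF derivation_subring] by (simp add: monom_altdef)
  have "a \<in> A'" if "a \<in> A" for a
    unfolding A'_def by (rule image_eqI[OF _ const[OF that]]) simp
  moreover have "t \<in> A'"
    unfolding A'_def by (rule image_eqI[OF _ X]) simp
  moreover have D'a: "D' a = D a" if "a \<in> A" for a
    using D'[OF const[OF that]] by (simp add: formal_deriv_pCons derivation_onD[OF D])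
  moreover have "D' t = c"
    using D'[OF X] by (simp add: formal_deriv_pCons derivation_onD[OF D])
  moreover have "derivation_on A' D'"
    unfolding derivation_on_def subring_over_rat_def
  proof (intro conjI allI ballI)
    show "D' (of_rat c) = 0" for c
      by (simp add: D'a subring_over_ratD(1)[OF derivation_subring] derivation_onD[OF D])
    show "of_rat c \<in> A'" for c
      using \<open>\<And>a. a \<in> A \<Longrightarrow> a \<in> A'\<close> subring_over_ratD(1)[OF derivation_subring] by blast
    fix r s assume "r \<in> A'" "s \<in> A'"
    then obtain P Q where P: "P \<in> polys_over A" "r = poly P t" and Q: "Q \<in> polys_over A" "s = poly Q t"
      by (auto simp: A'_def)
    have sum: "r + s = poly (P + Q) t" and prod: "r * s = poly (P * Q) t"
      by (simp_all add: P Q)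
    show "r + s \<in> A'" "r * s \<in> A'"
      unfolding A'_def sum prod using cl(1,3) P Q by blast+
    show "D' (r + s) = D' r + D' s"
      unfolding sum D'[OF cl(1)[OF P(1) Q(1)]] by (simp add: P Q D' formal_deriv_add)
    show "D' (r * s) = D' r * s + r * D' s"
      unfolding prod D'[OF cl(3)[OF P(1) Q(1)]] by (simp add: P Q D' formal_deriv_mult)
  qed
  ultimately show ?thesis using A'_def by blast
qed

text \<open>The zero polynomial is the only relation, so every image \<open>c\<close> is
  consistent.\<close>

lemma derivation_extend_transcendental:
  assumes "transcendental_over A t"
  shows "\<exists>A' D'. derivation_on A' D' \<and> A' = (\<lambda>P. poly P t) ` polys_over A \<and> A \<subseteq> A' \<and> t \<in> A' \<and>
    (\<forall>a\<in>A. D' a = D a) \<and> D' t = c"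
  by (rule derivation_extend_by) (use assms in \<open>auto simp: transcendental_over_def\<close>)

text \<open>An annihilating polynomial \<open>P\<close> of minimal degree has \<open>P'(t) \<noteq> 0\<close>, so it determines the
  image of \<open>t\<close>; all other relations follow by reducing their degree modulo \<open>P\<close>.\<close>

lemma derivation_extend_algebraic:
  assumes "\<not> transcendental_over A t"
  shows "\<exists>c A' D'. derivation_on A' D' \<and> A' = (\<lambda>P. poly P t) ` polys_over A \<and> A \<subseteq> A' \<and> t \<in> A' \<and>
    (\<forall>a\<in>A. D' a = D a) \<and> D' t = c"
proof -
  note cl = polys_over_closed[OF derivation_subring]
  let ?ann = "\<lambda>P. P \<in> polys_over A \<and> poly P t = 0 \<and> P \<noteq> 0"
  define P where "P = arg_min degree ?ann"
  obtain P0 where "?ann P0" using assms by (auto simp: transcendental_over_def)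
  then have P: "?ann P" and min: "degree P \<le> degree Q" if "?ann Q" for Q
    unfolding P_def by (rule arg_min_natI, use that in \<open>intro arg_min_nat_le\<close>)
  have Pann: "?ann P" using P \<open>?ann P0\<close> by blast
  have deg: "degree P \<noteq> 0"
    using Pann by (metis degree_eq_zeroE mult_zero_right add_0_right pCons_0_0 poly_0 poly_pCons)
  have "poly (pderiv P) t \<noteq> 0"
  proof
    assume "poly (pderiv P) t = 0"
    moreover have "pderiv P \<noteq> 0" using deg by (simp add: pderiv_eq_0_iff)
    ultimately have "degree P \<le> degree (pderiv P)"
      using Pann cl(4) by (intro min) auto
    then show False using deg by (simp add: degree_pderiv)
  qed
  \<comment> \<open>The solution of \<open>formal_deriv D t c P = 0\<close> for
    \<open>c\<close>.\<close>
  define c where "c = - poly (map_poly D P) t / poly (pderiv P) t"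
  have P0: "formal_deriv D t c P = 0"
    using \<open>poly (pderiv P) t \<noteq> 0\<close> by (simp add: formal_deriv_def c_def)
  have key: "formal_deriv D t c S = 0" if "S \<in> polys_over A" "poly S t = 0" for S
    using that
  proof (induction "degree S" arbitrary: S rule: less_induct)
    case less
    show ?case
    proof (cases "S = 0")
      case False
      define k where "k = degree S - degree P"
      have ge: "degree P \<le> degree S" using less.prems False by (intro min) auto
      \<comment> \<open>One step of pseudo-division: \<open>A\<close> is a ring, so \<open>S\<close>
        is multiplied by the leading coefficient of \<open>P\<close> instead of dividing by it. This
        nonzero real factor is cancelled at the end.\<close>
      define S' where "S' = smult (lead_coeff P) S - monom (lead_coeff S) k * P"
      have lc: "lead_coeff P \<in> A" "lead_coeff S \<in> A"
        using Pann less.prems by (auto simp: polys_over_def)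
      have mem: "monom (lead_coeff S) k * P \<in> polys_over A" "smult (lead_coeff P) S \<in> polys_over A"
        using lc Pann less.prems cl(3,5,6) by auto
      then have S': "S' \<in> polys_over A" "poly S' t = 0"
        unfolding S'_def using cl(2) Pann less.prems by auto
      have eq: "degree (monom (lead_coeff S) k * P) = degree S"
        using False Pann ge by (simp add: degree_mult_eq degree_monom_eq k_def)
      have "S' = 0 \<or> degree S' < degree S"
      proof (rule disjCI)
        assume "\<not> degree S' < degree S"
        moreover have "degree S' \<le> degree S"
          unfolding S'_def by (rule degree_diff_le) (simp_all add: eq)
        ultimately have d: "degree S' = degree S" by simp
        have "coeff (monom (lead_coeff S) k * P) (degree S) = lead_coeff S * lead_coeff P"
          using ge by (simp add: coeff_monom_mult k_def)
        then have "coeff S' (degree S) = 0"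
          by (simp add: S'_def)
        then show "S' = 0" using d by (metis leading_coeff_0_iff)
      qed
      then have 0: "formal_deriv D t c S' = 0"
        using less.hyps S' by (metis formal_deriv_0)
      have mon: "monom (lead_coeff S) k \<in> polys_over A" using cl(5) lc by blast
      have "formal_deriv D t c (smult (lead_coeff P) S)
          = formal_deriv D t c S' + formal_deriv D t c (monom (lead_coeff S) k * P)"
        by (subst formal_deriv_add[symmetric]) (use S' mem in \<open>auto simp: S'_def\<close>)
      then have "lead_coeff P * formal_deriv D t c S = 0"
        using Pann less.prems lc mon
        by (simp add: 0 formal_deriv_mult formal_deriv_smult P0)
      then show ?thesis using Pann by simp
    qed simp
  qed
  show ?thesis
    using derivation_extend_by[of t c, OF key] by blast
qed

lemma derivation_extend:
  "\<exists>A' D'. derivation_on A' D' \<and> A \<subseteq> A' \<and> t \<in> A' \<and> (\<forall>a\<in>A. D' a = D a)"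
  using derivation_extend_transcendental[of t 0] derivation_extend_algebraic[of t] by blast

end

text \<open>Adjoining one element at a time suffices, since only coordinates or measured values of
  one configuration are ever added.\<close>

lemma derivation_extend_finite:
  assumes "finite F" "derivation_on A D"
  shows "\<exists>A' D'. derivation_on A' D' \<and> A \<subseteq> A' \<and> F \<subseteq> A' \<and> (\<forall>a\<in>A. D' a = D a)"
  using assms(1)
proof induction
  case empty
  then show ?case using assms(2) by blast
next
  case (insert t F)
  then obtain A' D' where 1: "derivation_on A' D'" "A \<subseteq> A'" "F \<subseteq> A'" "\<forall>a\<in>A. D' a = D a"
    by blast
  obtain A'' D'' where 2: "derivation_on A'' D''" "A' \<subseteq> A''" "t \<in> A''" "\<forall>a\<in>A'. D'' a = D' a"
    using derivation_extend[OF 1(1), of t] by blast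
  have "\<forall>a\<in>A. D'' a = D a" using 1(2,4) 2(4) by (metis subsetD)
  then show ?case using 1 2 by blast
qed

text \<open>The inclusion in \<open>ratring I x\<close> is carried along for the induction: the next
  \<open>x i\<close> is transcendental over that ring and hence over \<open>A\<close>.\<close>

lemma ex_derivation_ratring:
  assumes "finite I" "alg_independent_over_rat I x"
  shows "\<exists>A D. derivation_on A D \<and> A \<subseteq> ratring I x \<and> (\<forall>i\<in>I. x i \<in> A \<and> D (x i) = b i)"
  using assms
proof (induction I)
  case empty
  let ?A = "range of_rat :: real set"
  have "derivation_on ?A (\<lambda>_. 0)"
    by (auto simp: derivation_on_def subring_over_rat_def simp flip: of_rat_add of_rat_mult)
  moreover have "?A \<subseteq> ratring {} x" by (auto simp: ratring_rat)
  ultimately show ?case by blast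
next
  case (insert i I)
  have "alg_independent_over_rat I x"
    using insert.prems by (rule alg_independent_mono) auto
  then obtain A D where A: "derivation_on A D" "A \<subseteq> ratring I x" "\<forall>i\<in>I. x i \<in> A \<and> D (x i) = b i"
    using insert.IH by blast
  have "transcendental_over A (x i)"
    using transcendental_if_alg_independent_insert[OF insert.prems insert.hyps(2)] A(2)
      polys_over_mono[OF A(2)] by (auto simp: transcendental_over_def)
  then obtain A' D' where A': "derivation_on A' D'" "A' = (\<lambda>P. poly P (x i)) ` polys_over A"
    "A \<subseteq> A'" "x i \<in> A'" "\<forall>a\<in>A. D' a = D a" "D' (x i) = b i"
    using derivation_extend_transcendental[OF A(1), of "x i" "b i"] by blast
  have "A' \<subseteq> ratring (insert i I) x"
  proof -
    have "polys_over A \<subseteq> polys_over (ratring (insert i I) x)"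
      using A(2) ratring_mono[of I "insert i I" x] by (intro polys_over_mono) auto
    then show ?thesis
      unfolding A'(2) using poly_in_subring[OF subring_ratring] ratring_gen[of i "insert i I" x]
      by blast
  qed
  moreover have "\<forall>j\<in>insert i I. x j \<in> A' \<and> D' (x j) = b j"
    using A(3) A'(3-6) by auto
  ultimately show ?case using A'(1) by blast
qed

text \<open>One half of the derivation criterion for algebraic independence; \<open>F\<close> holds
  further numbers to which the derivation is to be applied.\<close>

lemma ex_derivation:
  assumes "finite I" "alg_independent_over_rat I x" "finite F"
  shows "\<exists>A D. derivation_on A D \<and> F \<subseteq> A \<and> (\<forall>i\<in>I. x i \<in> A \<and> D (x i) = b i)"
proof -
  obtain A D where A: "derivation_on A D" "\<forall>i\<in>I. x i \<in> A \<and> D (x i) = b i"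
    using ex_derivation_ratring[OF assms(1,2), of b] by blast
  obtain A' D' where "derivation_on A' D'" "A \<subseteq> A'" "F \<subseteq> A'" "\<forall>a\<in>A. D' a = D a"
    using derivation_extend_finite[OF assms(3) A(1)] by blast
  then show ?thesis using A(2) by (metis subsetD)
qed

text \<open>The other half. If \<open>x i\<close> had a minimal annihilating polynomial
  \<open>P\<close> over the remaining numbers, the derivation that is 1 at \<open>x i\<close> and 0
  at the others would give \<open>P'(x i) = 0\<close>, against minimality.\<close>

lemma alg_independent_if_derivations:
  assumes "finite I"
    and "\<And>i. i \<in> I \<Longrightarrow> \<exists>A D. derivation_on A D \<and>
      (\<forall>j\<in>I. x j \<in> A \<and> D (x j) = (if j = i then 1 else 0))"
  shows "alg_independent_over_rat I x"
  using assms
proof (induction I)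
  case empty
  then show ?case by (simp add: alg_independent_empty)
next
  case (insert i I)
  have "alg_independent_over_rat I x"
  proof (rule insert.IH)
    fix k assume "k \<in> I"
    then show "\<exists>A D. derivation_on A D \<and> (\<forall>j\<in>I. x j \<in> A \<and> D (x j) = (if j = k then 1 else 0))"
      using insert.prems[of k] by blast
  qed
  moreover have "transcendental_over (ratring I x) (x i)"
  proof (rule ccontr)
    let ?R = "ratring I x"
    let ?ann = "\<lambda>P. P \<in> polys_over ?R \<and> poly P (x i) = 0 \<and> P \<noteq> 0"
    assume "\<not> transcendental_over ?R (x i)"
    then obtain P0 where P0: "?ann P0" by (auto simp: transcendental_over_def)
    define P where "P = arg_min degree ?ann"
    have P: "?ann P" unfolding P_def using P0 by (rule arg_min_natI)
    have min: "degree P \<le> degree Q" if "?ann Q" for Q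
      unfolding P_def using that by (rule arg_min_nat_le)
    have "\<exists>A D. derivation_on A D \<and>
      (\<forall>j\<in>insert i I. x j \<in> A \<and> D (x j) = (if j = i then 1 else 0))"
      by (rule insert.prems) simp
    then obtain A D where D: "derivation_on A D"
      "\<And>j. j \<in> insert i I \<Longrightarrow> x j \<in> A" "\<And>j. j \<in> insert i I \<Longrightarrow> D (x j) = (if j = i then 1 else 0)"
      by blast
    \<comment> \<open>The elements killed by \<open>D\<close> form a ring, so \<open>D\<close> kills
      all coefficients of \<open>P\<close>.\<close>
    have RA: "?R \<subseteq> {r\<in>A. D r = 0}"
    proof (rule ratring_least)
      show "subring_over_rat {r\<in>A. D r = 0}"
        using derivation_onD[OF D(1)] subring_over_ratD[OF derivation_onD(1)[OF D(1)]]
        by (auto simp: subring_over_rat_def)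
      show "x j \<in> {r\<in>A. D r = 0}" if "j \<in> I" for j
        using D(2,3)[of j] that insert.hyps by auto
    qed
    have PA: "P \<in> polys_over A"
      using P polys_over_mono[of ?R A] RA by blast
    have "map_poly D P = 0"
      using P RA by (intro poly_eqI) (auto simp: coeff_map_poly derivation_onD[OF D(1)] polys_over_def)
    moreover have "D (poly P (x i)) = 0"
      using P by (simp add: derivation_onD[OF D(1)])
    ultimately have 0: "poly (pderiv P) (x i) = 0"
      using derivation_poly[OF D(1) PA D(2)[of i]] D(3)[of i] by (simp add: formal_deriv_def)
    have "pderiv P = 0"
    proof (rule ccontr)
      assume nz: "pderiv P \<noteq> 0"
      then have "degree P \<le> degree (pderiv P)"
        using 0 P polys_over_closed(4)[OF subring_ratring] by (intro min) auto
      moreover have "degree P \<noteq> 0" using nz by (simp add: pderiv_eq_0_iff)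
      ultimately show False by (simp add: degree_pderiv)
    qed
    then have "degree P = 0" by (simp add: pderiv_eq_0_iff)
    then obtain a where "P = [:a:]" by (rule degree_eq_zeroE)
    then show False using P by simp
  qed
  ultimately show ?case by (rule alg_independent_insertI)
qed

section \<open>Generic extensions and transfer between generic points\<close>

lemma countable_polys_over:
  assumes "countable A" shows "countable (polys_over A)"
proof -
  have "coeffs ` polys_over A \<subseteq> lists A"
    by (auto simp: polys_over_def coeffs_def split: if_splits)
  then have "countable (coeffs ` polys_over A)"
    by (rule countable_subset) (rule countable_lists[OF assms])
  moreover have "inj_on coeffs (polys_over A)"
    by (auto intro: inj_onI simp: coeffs_eq_iff)
  ultimately show ?thesis by (rule countable_image_inj_on)
qed

lemma countable_algebraic:
  assumes "countable A" shows "countable {t. \<not> transcendental_over A t}"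
proof -
  have "{t. \<not> transcendental_over A t} = (\<Union>P\<in>polys_over A - {0}. {t. poly P t = 0})"
    by (auto simp: transcendental_over_def)
  moreover have "countable (\<Union>P\<in>polys_over A - {0}. {t. poly P t = 0})"
    using countable_polys_over[OF assms]
    by (intro countable_UN) (auto intro: countable_finite poly_roots_finite)
  ultimately show ?thesis by simp
qed

lemma countable_ratring:
  assumes "finite I" shows "countable (ratring I x)"
  using assms
proof induction
  case empty
  have "ratring {} x \<subseteq> range of_rat"
    by (rule ratring_least) (auto simp: subring_over_rat_def simp flip: of_rat_add of_rat_mult)
  then show ?case by (rule countable_subset) auto
next
  case (insert i I)
  let ?R = "ratring I x"
  note cl = polys_over_closed[OF subring_ratring[of I x]]
    and R = subring_over_ratD[OF subring_ratring[of I x]]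
  let ?S = "(\<lambda>P. poly P (x i)) ` polys_over ?R"
  have const: "a \<in> ?S" if "a \<in> ?R" for a
    by (rule image_eqI[of _ _ "monom a 0"]) (use that cl(5) in \<open>auto simp: poly_monom\<close>)
  have "subring_over_rat ?S"
    unfolding subring_over_rat_def
  proof (intro conjI allI ballI)
    show "of_rat c \<in> ?S" for c by (intro const R(1))
    fix a b assume "a \<in> ?S" "b \<in> ?S"
    then obtain P Q where P: "P \<in> polys_over ?R" "a = poly P (x i)"
      and Q: "Q \<in> polys_over ?R" "b = poly Q (x i)" by auto
    show "a + b \<in> ?S"
      by (rule image_eqI[of _ _ "P + Q"]) (use P Q cl(1) in auto)
    show "a * b \<in> ?S"
      by (rule image_eqI[of _ _ "P * Q"]) (use P Q cl(3) in auto)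
  qed
  moreover have "x j \<in> ?S" if "j \<in> insert i I" for j
  proof (cases "j = i")
    case True
    have "monom 1 1 \<in> polys_over ?R" by (intro cl(5) R(5))
    then have "poly (monom 1 1) (x i) \<in> ?S" by (rule imageI)
    with True show ?thesis by (simp add: poly_monom)
  next
    case False
    with that show ?thesis by (intro const ratring_gen) auto
  qed
  ultimately have "ratring (insert i I) x \<subseteq> ?S"
    by (rule ratring_least)
  then show ?case
    by (rule countable_subset) (intro countable_image countable_polys_over insert.IH)
qed

text \<open>At each step only countably many reals are algebraic over the ring generated so far,
  while every open interval around \<open>c j\<close> is uncountable.\<close>

lemma ex_alg_independent_extension:
  assumes "finite J" "finite I" "I \<inter> J = {}" "alg_independent_over_rat I x" "0 < \<epsilon>"
  shows "\<exists>x'. (\<forall>k. k \<notin> J \<longrightarrow> x' k = x k) \<and> (\<forall>j\<in>J. \<bar>x' j - c j\<bar> < \<epsilon>) \<and>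
    alg_independent_over_rat (I \<union> J) x'"
  using assms(1,3)
proof (induction J)
  case empty
  then show ?case using assms(4) by (intro exI[of _ x]) simp
next
  case (insert j J)
  have "I \<inter> J = {}" using insert.prems by blast
  from insert.IH[OF this] obtain x' where x': "\<forall>k. k \<notin> J \<longrightarrow> x' k = x k" "\<forall>j\<in>J. \<bar>x' j - c j\<bar> < \<epsilon>"
    "alg_independent_over_rat (I \<union> J) x'" by blast
  let ?A = "{t. \<not> transcendental_over (ratring (I \<union> J) x') t}"
  have "countable ?A"
    using insert.hyps assms(2) by (intro countable_algebraic countable_ratring) auto
  moreover have "uncountable {c j - \<epsilon><..<c j + \<epsilon>}"
    using assms(5) by (simp add: uncountable_open_interval)
  ultimately have "\<not> {c j - \<epsilon><..<c j + \<epsilon>} \<subseteq> ?A"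
    using countable_subset by blast
  then obtain t where t: "t \<in> {c j - \<epsilon><..<c j + \<epsilon>}" "t \<notin> ?A"
    unfolding subset_eq by blast
  define x'' where "x'' = x'(j := t)"
  have j: "j \<notin> I \<union> J" using insert by auto
  have eq: "x'' k = x' k" if "k \<in> I \<union> J" for k using j that by (auto simp: x''_def)
  have "alg_independent_over_rat (I \<union> J) x''"
    using x'(3) alg_independent_cong[of "I \<union> J" x'' x'] eq by blast
  moreover have "ratring (I \<union> J) x'' = ratring (I \<union> J) x'"
    unfolding ratring_def
    by (intro image_cong refl eval_rat_poly_cong[where I="I \<union> J"] eq) (auto simp: ratpolys_def)
  then have "transcendental_over (ratring (I \<union> J) x'') (x'' j)"
    using t by (simp add: x''_def)
  ultimately have "alg_independent_over_rat (insert j (I \<union> J)) x''"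
    by (rule alg_independent_insertI)
  moreover have "\<forall>k. k \<notin> insert j J \<longrightarrow> x'' k = x k"
    using x'(1) by (simp add: x''_def)
  moreover have "\<forall>k\<in>insert j J. \<bar>x'' k - c k\<bar> < \<epsilon>"
    using x'(2) t(1) by (auto simp: x''_def abs_less_iff)
  ultimately show ?case by (intro exI[of _ x'']) simp
qed

text \<open>\<open>Q\<close> is chosen before \<open>z\<close>: one rational polynomial represents
  \<open>f\<close> everywhere, so a zero at a single generic point forces \<open>f\<close> to vanish
  identically.\<close>

definition rat_poly_fun :: "('a \<Rightarrow> 'i \<Rightarrow> real) \<Rightarrow> ('a \<Rightarrow> real) \<Rightarrow> bool" where
  "rat_poly_fun c f \<longleftrightarrow> (\<exists>Q. \<forall>z. f z = eval_rat_poly (c z) Q)"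

lemma rat_poly_fun_const: "rat_poly_fun c (\<lambda>z. of_rat r)"
  unfolding rat_poly_fun_def by (rule exI[of _ "single 0 r"]) simp

lemma rat_poly_fun_coord: "rat_poly_fun c (\<lambda>z. c z i)"
  unfolding rat_poly_fun_def by (rule exI[of _ "single (single i 1) 1"]) simp

lemma rat_poly_fun_add:
  "rat_poly_fun c f \<Longrightarrow> rat_poly_fun c g \<Longrightarrow> rat_poly_fun c (\<lambda>z. f z + g z)"
proof -
  assume "rat_poly_fun c f" "rat_poly_fun c g"
  then obtain P Q where "\<forall>z. f z = eval_rat_poly (c z) P" "\<forall>z. g z = eval_rat_poly (c z) Q"
    by (auto simp: rat_poly_fun_def)
  then show ?thesis
    unfolding rat_poly_fun_def by (intro exI[of _ "P + Q"]) (simp add: eval_rat_poly_add)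
qed

lemma rat_poly_fun_mult:
  "rat_poly_fun c f \<Longrightarrow> rat_poly_fun c g \<Longrightarrow> rat_poly_fun c (\<lambda>z. f z * g z)"
proof -
  assume "rat_poly_fun c f" "rat_poly_fun c g"
  then obtain P Q where "\<forall>z. f z = eval_rat_poly (c z) P" "\<forall>z. g z = eval_rat_poly (c z) Q"
    by (auto simp: rat_poly_fun_def)
  then show ?thesis
    unfolding rat_poly_fun_def by (intro exI[of _ "P * Q"]) (simp add: eval_rat_poly_mult)
qed

lemma rat_poly_fun_diff:
  assumes "rat_poly_fun c f" "rat_poly_fun c g" shows "rat_poly_fun c (\<lambda>z. f z - g z)"
  using rat_poly_fun_add[OF assms(1) rat_poly_fun_mult[OF rat_poly_fun_const[of c "-1"] assms(2)]]
  by (simp add: of_rat_minus)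

lemma rat_poly_fun_sum:
  "(\<And>a. a \<in> S \<Longrightarrow> rat_poly_fun c (f a)) \<Longrightarrow> rat_poly_fun c (\<lambda>z. \<Sum>a\<in>S. f a z)"
proof (induction S rule: infinite_finite_induct)
  case (insert a S)
  then show ?case by (simp add: rat_poly_fun_add)
qed (use rat_poly_fun_const[of c 0] in auto)

lemma rat_poly_fun_prod:
  "(\<And>a. a \<in> S \<Longrightarrow> rat_poly_fun c (f a)) \<Longrightarrow> rat_poly_fun c (\<lambda>z. \<Prod>a\<in>S. f a z)"
proof (induction S rule: infinite_finite_induct)
  case (insert a S)
  then show ?case by (simp add: rat_poly_fun_mult)
qed (use rat_poly_fun_const[of c 1] in auto)

lemma rat_poly_fun_power: "rat_poly_fun c f \<Longrightarrow> rat_poly_fun c (\<lambda>z. f z ^ n)"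
proof (induction n)
  case 0
  then show ?case using rat_poly_fun_const[of c 1] by simp
next
  case (Suc n)
  then show ?case using rat_poly_fun_mult[of c f "\<lambda>z. f z ^ n"] by simp
qed

lemma rat_poly_fun_compose:
  assumes "\<And>k. rat_poly_fun c (\<lambda>z. g z k)"
  shows "rat_poly_fun c (\<lambda>z. eval_rat_poly (g z) M)"
  unfolding eval_rat_poly_def
  by (intro rat_poly_fun_sum rat_poly_fun_mult rat_poly_fun_const rat_poly_fun_prod
      rat_poly_fun_power assms)

lemma rat_poly_fun_eq_0:
  assumes "alg_independent_over_rat UNIV (c z)" "rat_poly_fun c f" "f z = 0"
  shows "f z' = 0"
proof -
  obtain Q where Q: "\<forall>z. f z = eval_rat_poly (c z) Q"
    using assms(2) by (auto simp: rat_poly_fun_def)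
  then have "Q = 0"
    using assms(1,3) by (auto simp: alg_independent_iff ratpolys_def)
  then show ?thesis using Q by simp
qed

text \<open>A relation at the generic point \<open>z'\<close> is an identity and therefore holds at
  \<open>z\<close> too. Only the target has to be generic.\<close>

lemma alg_independent_transfer:
  assumes "alg_independent_over_rat UNIV (c z')" "\<And>k. rat_poly_fun c (\<lambda>z. g z k)"
    and "alg_independent_over_rat K (g z)"
  shows "alg_independent_over_rat K (g z')"
  unfolding alg_independent_iff
proof (intro ballI impI)
  fix P assume P: "P \<in> ratpolys K" "eval_rat_poly (g z') P = 0"
  have "eval_rat_poly (g z) P = 0"
    by (rule rat_poly_fun_eq_0[where c=c and f="\<lambda>z. eval_rat_poly (g z) P", OF assms(1)
          rat_poly_fun_compose[OF assms(2)] P(2)])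
  then show "P = 0" using assms(3) P(1) by (simp add: alg_independent_iff)
qed

text \<open>An algebraic relation between polynomial functions at a generic point holds identically;
  so where the other functions keep independent values, the dependent one takes only finitely
  many values.\<close>

lemma dependent_value_finite:
  assumes z0: "alg_independent_over_rat UNIV (c z0)" and g: "\<And>k. rat_poly_fun c (\<lambda>z. g z k)"
    and dep: "\<not> alg_independent_over_rat (insert e K) (g z0)"
    and ind: "alg_independent_over_rat K (g q)"
    and S: "\<And>s k. s \<in> S \<Longrightarrow> k \<in> K \<Longrightarrow> g s k = g q k"
  shows "finite ((\<lambda>s. g s e) ` S)"
proof -
  obtain P where P: "P \<in> ratpolys (insert e K)" "P \<noteq> 0" "eval_rat_poly (g z0) P = 0"
    using dep by (auto simp: alg_independent_iff)
  have 0: "eval_rat_poly (g z) P = 0" for z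
    by (rule rat_poly_fun_eq_0[where c=c and f="\<lambda>z. eval_rat_poly (g z) P", OF z0
          rat_poly_fun_compose[OF g] P(3)])
  obtain R where R0: "(\<forall>k::nat. R k \<in> ratpolys K) \<and> finite {k. R k \<noteq> 0} \<and>
    (\<forall>x. eval_rat_poly x P = (\<Sum>k | R k \<noteq> 0. eval_rat_poly x (R k) * x e ^ k)) \<and>
    (P \<noteq> 0 \<longrightarrow> (\<exists>k. R k \<noteq> 0))"
    using ratpoly_split[OF P(1)] ..
  then have R: "\<And>k. R k \<in> ratpolys K" "finite {k. R k \<noteq> 0}"
    "\<And>x. eval_rat_poly x P = (\<Sum>k | R k \<noteq> 0. eval_rat_poly x (R k) * x e ^ k)"
    by simp_all
  obtain l where l: "R l \<noteq> 0" using R0 P(2) by blast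
  \<comment> \<open>The relation with its coefficients frozen at \<open>q\<close>. They involve only
    functions from \<open>K\<close>, so every \<open>s \<in> S\<close> yields a root of
    \<open>U\<close>; independence at \<open>q\<close> keeps the coefficient belonging to
    \<open>l\<close> nonzero.\<close>
  define U where "U = (\<Sum>k | R k \<noteq> 0. monom (eval_rat_poly (g q) (R k)) k)"
  have "coeff U l = eval_rat_poly (g q) (R l)"
    using R(2) l by (simp add: U_def coeff_sum)
  moreover have "eval_rat_poly (g q) (R l) \<noteq> 0"
    using l R(1)[of l] ind unfolding alg_independent_iff by blast
  ultimately have "U \<noteq> 0" by force
  then have "finite {t. poly U t = 0}" by (rule poly_roots_finite)
  moreover have "(\<lambda>s. g s e) ` S \<subseteq> {t. poly U t = 0}"
  proof safe
    fix s assume s: "s \<in> S"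
    have "eval_rat_poly (g s) (R k) = eval_rat_poly (g q) (R k)" for k
      by (rule eval_rat_poly_cong[where I=K]) (use R(1)[of k] S[OF s] in \<open>auto simp: ratpolys_def\<close>)
    then show "poly U (g s e) = 0"
      using R(3)[of "g s"] 0[of s] by (simp add: U_def poly_sum poly_monom)
  qed
  ultimately show ?thesis by (rule finite_subset[rotated])
qed

section \<open>Edge lengths and their gradients\<close>

text \<open>A family and not a set of vectors: the two orientations of an edge have the same row,
  and this repetition has to count as a dependence.\<close>

definition indep_family :: "('k \<Rightarrow> 'a::euclidean_space) \<Rightarrow> 'k set \<Rightarrow> bool" where
  "indep_family r K \<longleftrightarrow> inj_on r K \<and> independent (r ` K)"

lemma indep_family_finite: "indep_family r K \<Longrightarrow> finite K"
  unfolding indep_family_def by (auto intro: finite_imageD finiteI_independent)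

lemma indep_family_insert:
  assumes "e \<notin> K"
  shows "indep_family r (insert e K) \<longleftrightarrow> indep_family r K \<and> r e \<notin> span (r ` K)"
proof (cases "r e \<in> r ` K")
  case True
  then have "r e \<in> span (r ` K)" by (rule span_base)
  with True assms show ?thesis by (auto simp: indep_family_def inj_on_insert)
next
  case False
  with assms show ?thesis
    by (auto simp: indep_family_def inj_on_insert independent_insert)
qed

lemma indep_family_iff:
  assumes "finite K"
  shows "indep_family r K \<longleftrightarrow> (\<forall>c. (\<Sum>k\<in>K. c k *\<^sub>R r k) = 0 \<longrightarrow> (\<forall>k\<in>K. c k = 0))"
proof
  assume r: "indep_family r K"
  show "\<forall>c. (\<Sum>k\<in>K. c k *\<^sub>R r k) = 0 \<longrightarrow> (\<forall>k\<in>K. c k = 0)"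
  proof (intro allI impI ballI)
    fix c k assume 0: "(\<Sum>k\<in>K. c k *\<^sub>R r k) = 0" and k: "k \<in> K"
    have inj: "inj_on r K" using r by (simp add: indep_family_def)
    have "(\<Sum>v\<in>r ` K. c (inv_into K r v) *\<^sub>R v) = 0"
      using 0 by (simp add: sum.reindex[OF inj] inv_into_f_f[OF inj])
    moreover have "finite (r ` K)" "independent (r ` K)" using r assms by (auto simp: indep_family_def)
    ultimately have "c (inv_into K r (r k)) = 0"
      using k independentD[of "r ` K" "r ` K" "\<lambda>v. c (inv_into K r v)" "r k"] by blast
    then show "c k = 0" using inj k by simp
  qed
next
  assume c: "\<forall>c. (\<Sum>k\<in>K. c k *\<^sub>R r k) = 0 \<longrightarrow> (\<forall>k\<in>K. c k = 0)"
  have inj: "inj_on r K"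
  proof (rule inj_onI, rule ccontr)
    fix j k assume jk: "j \<in> K" "k \<in> K" "r j = r k" "j \<noteq> k"
    define a :: "'a \<Rightarrow> real" where "a i = (if i = j then 1 else if i = k then -1 else 0)" for i
    have "(\<Sum>i\<in>K. a i *\<^sub>R r i) = (\<Sum>i\<in>{j, k}. a i *\<^sub>R r i)"
      by (rule sum.mono_neutral_right) (use jk assms in \<open>auto simp: a_def\<close>)
    also have "\<dots> = 0" using jk by (simp add: a_def)
    finally have "a j = 0" using c jk(1) by blast
    then show False by (simp add: a_def)
  qed
  have "independent (r ` K)"
  proof (rule independent_if_scalars_zero)
    fix f x assume "(\<Sum>x\<in>r ` K. f x *\<^sub>R x) = 0" "x \<in> r ` K"
    then show "f x = 0"
      using c[rule_format, of "\<lambda>k. f (r k)"] by (auto simp: sum.reindex[OF inj])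
  qed (use assms in simp)
  with inj show "indep_family r K" by (simp add: indep_family_def)
qed

lemma indep_familyD:
  assumes "indep_family r K" "(\<Sum>k\<in>K. c k *\<^sub>R r k) = 0" "k \<in> K" shows "c k = 0"
  using assms indep_family_iff[OF indep_family_finite[OF assms(1)], of r] by blast

lemma indep_family_eqD:
  assumes "indep_family r K" "(\<Sum>k\<in>K. c k *\<^sub>R r k) = (\<Sum>k\<in>K. d k *\<^sub>R r k)" "k \<in> K"
  shows "c k = d k"
  using indep_familyD[OF assms(1), of "\<lambda>k. c k - d k"] assms(2,3)
  by (simp add: scaleR_diff_left sum_subtractf)

lemma indep_family_card_iff:
  fixes r :: "'k \<Rightarrow> 'a::euclidean_space"
  assumes "indep_family r K"
  shows "card K = DIM('a) \<longleftrightarrow> span (r ` K) = UNIV"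
proof -
  have "dim (r ` K) = card K"
    using assms by (simp add: indep_family_def dim_eq_card_independent card_image)
  then show ?thesis using dim_eq_full[of "r ` K"] by simp
qed

text \<open>Extend the prescribed functional linearly and represent it by the vector
  \<open>adjoint f 1\<close>.\<close>

lemma indep_family_dual:
  fixes r :: "'k \<Rightarrow> 'a::euclidean_space"
  assumes "indep_family r K"
  shows "\<exists>h. \<forall>k\<in>K. r k \<bullet> h = \<beta> k"
proof -
  have inj: "inj_on r K" and ind: "independent (r ` K)"
    using assms by (auto simp: indep_family_def)
  obtain f :: "'a \<Rightarrow> real" where f: "linear f" "\<forall>v\<in>r ` K. f v = \<beta> (inv_into K r v)"
    using linear_independent_extend[OF ind, of "\<lambda>v. \<beta> (inv_into K r v)"] by blast
  have "r k \<bullet> adjoint f 1 = \<beta> k" if "k \<in> K" for k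
    using f(2) that inj adjoint_works[OF f(1), of "r k" 1] by (simp add: inner_commute)
  then show ?thesis by blast
qed

text \<open>\<open>K\<close> is an independent family between \<open>B\<close> and \<open>D\<close>
  of greatest cardinality.\<close>

lemma indep_family_extend:
  assumes "finite D" "B \<subseteq> D" "indep_family r B"
  obtains K where "B \<subseteq> K" "K \<subseteq> D" "indep_family r K" "r ` D \<subseteq> span (r ` K)"
proof -
  let ?P = "\<lambda>K. B \<subseteq> K \<and> K \<subseteq> D \<and> indep_family r K"
  have "?P B" using assms by simp
  moreover have "\<forall>K. ?P K \<longrightarrow> card K < Suc (card D)"
    using assms(1) by (auto intro: card_mono simp: less_Suc_eq_le)
  ultimately have "\<exists>K. ?P K \<and> (\<forall>J. ?P J \<longrightarrow> card J \<le> card K)"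
    by (rule ex_has_greatest_nat)
  then obtain K where K': "?P K \<and> (\<forall>J. ?P J \<longrightarrow> card J \<le> card K)" ..
  then have K: "?P K" and max: "\<forall>J. ?P J \<longrightarrow> card J \<le> card K" by (rule conjunct1, rule conjunct2)
  have "r e \<in> span (r ` K)" if e: "e \<in> D" for e
  proof (cases "e \<in> K")
    case False
    show ?thesis
    proof (rule ccontr)
      assume "r e \<notin> span (r ` K)"
      then have "?P (insert e K)" using K e False by (auto simp: indep_family_insert)
      then have "card (insert e K) \<le> card K" using max by simp
      moreover have "finite K" using K assms(1) finite_subset by blast
      ultimately show False using False by simp
    qed
  qed (auto intro: span_base)
  then have "r ` D \<subseteq> span (r ` K)" by (rule image_subsetI)
  with K show thesis by (intro that[of K]) simp_all
qed

text \<open>Squared edge lengths and coordinates of a configuration, as one family of functions; the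
  gradient of a squared edge length is twice the row of the rigidity matrix.\<close>

definition measurement ::
    "real^'d^'v \<Rightarrow> ('v \<times> 'v) + ('v::finite \<times> 'd::finite) \<Rightarrow> real" where
  "measurement z k = (case k of Inl (a, b) \<Rightarrow> (norm (z $ a - z $ b))\<^sup>2 | Inr (w, i) \<Rightarrow> z $ w $ i)"

definition gradient ::
    "real^'d^'v \<Rightarrow> ('v \<times> 'v) + ('v::finite \<times> 'd::finite) \<Rightarrow> real^'d^'v" where
  "gradient z k = (case k of Inl (a, b) \<Rightarrow> 2 *\<^sub>R rigidity_row (($) z) a b
     | Inr (w, i) \<Rightarrow> axis w (axis i 1))"

definition coord :: "real^'d^'v \<Rightarrow> 'v::finite \<times> 'd::finite \<Rightarrow> real" where
  "coord z = (\<lambda>(w, i). z $ w $ i)"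

abbreviation generic_config :: "real^'d::finite^'v::finite \<Rightarrow> bool" where
  "generic_config z \<equiv> alg_independent_over_rat UNIV (coord z)"

lemma inner_rigidity_row:
  "rigidity_row p a b \<bullet> h = (p a - p b) \<bullet> (h $ a - h $ b)"
proof (cases "a = b")
  case True
  then show ?thesis by (simp add: inner_vec_def rigidity_row_def if_distrib cong: if_cong)
next
  case False
  have "rigidity_row p a b \<bullet> h
      = (\<Sum>w\<in>UNIV. (if w = a then (p a - p b) \<bullet> h $ a else 0) + (if w = b then (p b - p a) \<bullet> h $ b else 0))"
    unfolding inner_vec_def[of "rigidity_row p a b"]
    by (rule sum.cong) (use False in \<open>auto simp: rigidity_row_def\<close>)
  also have "\<dots> = (p a - p b) \<bullet> h $ a + (p b - p a) \<bullet> h $ b"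
    by (simp add: sum.distrib)
  finally show ?thesis by (simp add: algebra_simps)
qed

lemma inner_gradient_Inl:
  "gradient z (Inl (a, b)) \<bullet> h = 2 * ((z $ a - z $ b) \<bullet> (h $ a - h $ b))"
  by (simp add: gradient_def inner_rigidity_row)

lemma inner_gradient_Inr: "gradient z (Inr (w, i)) \<bullet> h = h $ w $ i"
  by (simp add: gradient_def inner_axis' inner_axis)

lemma rat_poly_fun_measurement:
  "rat_poly_fun (coord :: real^'d::finite^'v::finite \<Rightarrow> _) (\<lambda>z. measurement z k)"
proof (cases k)
  case (Inl e)
  obtain a b where e: "e = (a, b)" by (cases e)
  have "measurement z k = (\<Sum>i\<in>UNIV. (coord z (a, i) - coord z (b, i))\<^sup>2)" for z :: "real^'d^'v"
    by (simp add: measurement_def Inl e power2_norm_eq_inner inner_vec_def coord_def)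
       (simp add: power2_eq_square)
  then show ?thesis
    by (simp only:) (intro rat_poly_fun_sum rat_poly_fun_power rat_poly_fun_diff rat_poly_fun_coord)
next
  case (Inr c)
  have "measurement z k = coord z c" for z :: "real^'d^'v"
    by (cases c) (simp add: measurement_def Inr coord_def)
  then show ?thesis by (simp only: rat_poly_fun_coord)
qed

lemma derivation_sum:
  assumes "derivation_on A D" "\<And>i. i \<in> S \<Longrightarrow> f i \<in> A"
  shows "D (\<Sum>i\<in>S. f i) = (\<Sum>i\<in>S. D (f i))"
  using assms(2)
proof (induction S rule: infinite_finite_induct)
  case (insert i S)
  have "(\<Sum>i\<in>S. f i) \<in> A"
    using insert.prems by (intro subring_sum derivation_onD(1)[OF assms(1)]) auto
  then show ?case
    using insert by (simp add: derivation_onD(5)[OF assms(1)])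
qed (simp_all add: derivation_onD[OF assms(1)])

text \<open>Chain rule. The values of a derivation on the coordinates form a vector that is paired
  with the gradient; this links the algebra to the rigidity matrix.\<close>

lemma derivation_measurement:
  assumes D: "derivation_on A D" and A: "\<And>w i. z $ w $ i \<in> A"
  shows "D (measurement z k) = gradient z k \<bullet> (\<chi> w i. D (z $ w $ i))"
proof (cases k)
  case (Inl e)
  obtain a b where e: "e = (a, b)" by (cases e)
  note R = subring_over_ratD[OF derivation_onD(1)[OF D]]
  have mem: "z $ a $ i - z $ b $ i \<in> A" for i by (intro R A)
  have "measurement z k = (\<Sum>i\<in>UNIV. (z $ a $ i - z $ b $ i) * (z $ a $ i - z $ b $ i))"
    by (simp add: measurement_def Inl e power2_norm_eq_inner inner_vec_def)
  also have "D \<dots> = (\<Sum>i\<in>UNIV. D ((z $ a $ i - z $ b $ i) * (z $ a $ i - z $ b $ i)))"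
    by (rule derivation_sum[OF D]) (intro R mem)
  also have "\<dots> = (\<Sum>i\<in>UNIV. 2 * ((z $ a $ i - z $ b $ i) * (D (z $ a $ i) - D (z $ b $ i))))"
    by (simp only: derivation_onD(6)[OF D mem mem] derivation_onD(7)[OF D A A])
       (simp add: mult.commute)
  also have "\<dots> = gradient z k \<bullet> (\<chi> w i. D (z $ w $ i))"
    unfolding Inl e inner_gradient_Inl by (simp add: inner_vec_def sum_distrib_left)
  finally show ?thesis .
next
  case (Inr c)
  obtain w i where "c = (w, i)" by (cases c)
  then show ?thesis by (simp add: Inr inner_gradient_Inr measurement_def)
qed

text \<open>At a generic point every vector \<open>h\<close> comes from a derivation; the vectors
  dual to the gradients give derivations separating the measurements.\<close>

lemma alg_independent_measurement:
  assumes "generic_config z" "indep_family (gradient z) K"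
  shows "alg_independent_over_rat K (measurement z)"
proof (rule alg_independent_if_derivations)
  show fin: "finite K" by simp
  fix e assume "e \<in> K"
  obtain h where h: "\<forall>k\<in>K. gradient z k \<bullet> h = (if k = e then 1 else 0)"
    using indep_family_dual[OF assms(2), of "\<lambda>k. if k = e then 1 else 0"] ..
  obtain A D where A: "derivation_on A D" "measurement z ` K \<subseteq> A"
    "\<forall>c\<in>UNIV. coord z c \<in> A \<and> D (coord z c) = (case c of (w, i) \<Rightarrow> h $ w $ i)"
    using ex_derivation[OF finite assms(1), of "measurement z ` K" "\<lambda>(w, i). h $ w $ i"] by auto
  have c: "z $ w $ i \<in> A" "D (z $ w $ i) = h $ w $ i" for w i
    using A(3) by (auto simp: coord_def)
  then have "(\<chi> w i. D (z $ w $ i)) = h" by (simp add: vec_eq_iff)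
  then have "D (measurement z k) = (if k = e then 1 else 0)" if "k \<in> K" for k
    using derivation_measurement[OF A(1) c(1), of k] h that by simp
  then show "\<exists>A D. derivation_on A D \<and>
      (\<forall>k\<in>K. measurement z k \<in> A \<and> D (measurement z k) = (if k = e then 1 else 0))"
    using A(1,2) by (intro exI[of _ A] exI[of _ D]) auto
qed

text \<open>Here \<open>z\<close> may be any configuration: the derivation is prescribed on the
  independent measured values and then extended to the coordinates.\<close>

lemma ex_measurement_derivation:
  fixes z :: "real^'d::finite^'v::finite"
  assumes "alg_independent_over_rat K (measurement z)"
  shows "\<exists>A D. derivation_on A D \<and> (\<forall>w i. z $ w $ i \<in> A) \<and>
    (\<forall>k\<in>K. gradient z k \<bullet> (\<chi> w i. D (z $ w $ i)) = \<beta> k)"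
proof -
  obtain A D where A: "derivation_on A D" "range (coord z) \<subseteq> A"
    "\<forall>k\<in>K. measurement z k \<in> A \<and> D (measurement z k) = \<beta> k"
    using ex_derivation[OF finite assms, of "range (coord z)" \<beta>] by auto
  have c: "z $ w $ i \<in> A" for w i
    using A(2) by (auto simp: coord_def)
  show ?thesis
    using A(1,3) c derivation_measurement[OF A(1) c] by (intro exI[of _ A] exI[of _ D]) simp
qed

text \<open>Derivations that are 1 at one measurement and 0 at the others provide vectors dual to
  the gradients. This is what controls the rigidity matrix at the possibly non-generic
  \<open>q\<close>.\<close>

lemma indep_gradient:
  assumes "alg_independent_over_rat K (measurement z)"
  shows "indep_family (gradient z) K"
  unfolding indep_family_iff[OF finite[of K]]
proof (intro allI impI ballI)
  fix c e assume 0: "(\<Sum>k\<in>K. c k *\<^sub>R gradient z k) = 0" and e: "e \<in> K"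
  obtain D where D: "\<forall>k\<in>K. gradient z k \<bullet> (\<chi> w i. D (z $ w $ i)) = (if k = e then 1 else 0)"
    using ex_measurement_derivation[OF assms, of "\<lambda>k. if k = e then 1 else 0"] by blast
  have "0 = (\<Sum>k\<in>K. c k *\<^sub>R gradient z k) \<bullet> (\<chi> w i. D (z $ w $ i))"
    by (simp add: 0)
  also have "\<dots> = (\<Sum>k\<in>K. c k * (if k = e then 1 else 0))"
    using D by (simp add: inner_sum_left)
  also have "\<dots> = (\<Sum>k\<in>K. if k = e then c k else 0)"
    by (rule sum.cong) auto
  also have "\<dots> = c e" using e by simp
  finally show "c e = 0" by simp
qed

text \<open>A substitute for comparing transcendence degrees. The gradients span, so a derivation
  agreeing with \<open>h\<close> on all measurements in \<open>K\<close> has coordinate vector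
  \<open>h\<close>, and \<open>h\<close> may be any standard basis vector.\<close>

lemma generic_if_enough_measurements:
  fixes z :: "real^'d::finite^'v::finite"
  assumes "alg_independent_over_rat K (measurement z)" "card K = DIM(real^'d^'v)"
  shows "generic_config z"
proof (rule alg_independent_if_derivations)
  fix c :: "'v \<times> 'd"
  define h :: "real^'d^'v" where "h = (\<chi> w i. if (w, i) = c then 1 else 0)"
  obtain A D where A: "derivation_on A D" "\<forall>w i. z $ w $ i \<in> A"
    and D: "\<forall>k\<in>K. gradient z k \<bullet> (\<chi> w i. D (z $ w $ i)) = gradient z k \<bullet> h"
    using ex_measurement_derivation[OF assms(1), of "\<lambda>k. gradient z k \<bullet> h"] by blast
  have span: "span (gradient z ` K) = UNIV"
    using indep_family_card_iff[OF indep_gradient[OF assms(1)]] assms(2) by blast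
  let ?u = "(\<chi> w i. D (z $ w $ i)) - h"
  have orth: "orthogonal ?u y" if "y \<in> gradient z ` K" for y
  proof -
    obtain k where k: "k \<in> K" "y = gradient z k" using \<open>y \<in> gradient z ` K\<close> by blast
    then have "y \<bullet> ?u = 0" using D by (simp add: inner_diff_right)
    then show ?thesis by (simp add: orthogonal_def inner_commute)
  qed
  have "?u \<in> span (gradient z ` K)" unfolding span by (rule UNIV_I)
  then have "orthogonal ?u ?u" using orth by (rule orthogonal_to_span)
  then have "(\<chi> w i. D (z $ w $ i)) = h" by (simp add: orthogonal_self)
  then have "D (z $ w $ i) = (if (w, i) = c then 1 else 0)" for w i
    by (simp add: h_def vec_eq_iff)
  then show "\<exists>A D. derivation_on A D \<and>
      (\<forall>j\<in>UNIV. coord z j \<in> A \<and> D (coord z j) = (if j = c then 1 else 0))"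
    using A by (intro exI[of _ A] exI[of _ D]) (auto simp: coord_def)
qed simp

section \<open>Fibres of the edge length map\<close>

lemma continuous_on_gradient: "continuous_on S (\<lambda>z. gradient z k)"
proof (cases k)
  case (Inl e)
  obtain a b where e: "e = (a, b)" by (cases e)
  have "continuous_on S (\<lambda>z. if w = a then z $ a - z $ b else if w = b then z $ b - z $ a else 0)"
    for w
    by (cases "w = a"; cases "w = b") (auto intro!: continuous_intros)
  then show ?thesis
    unfolding Inl e gradient_def rigidity_row_def sum.case prod.case
    by (intro continuous_on_scaleR continuous_on_const continuous_on_vec_lambda)
next
  case (Inr c)
  then show ?thesis by (cases c) (simp add: gradient_def)
qed

lemma measurement_has_derivative:
  "((\<lambda>z. measurement z k) has_derivative (\<lambda>h. gradient z k \<bullet> h)) (at z)"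
proof (cases k)
  case (Inl e)
  obtain a b where e: "e = (a, b)" by (cases e)
  show ?thesis
    unfolding Inl e inner_gradient_Inl measurement_def sum.case prod.case power2_norm_eq_inner
    by (auto intro!: derivative_eq_intros bounded_linear.has_derivative[OF bounded_linear_vec_nth]
        simp: inner_commute)
next
  case (Inr c)
  obtain w i where c: "c = (w, i)" by (cases c)
  show ?thesis
    unfolding Inr c inner_gradient_Inr measurement_def sum.case prod.case
    by (intro bounded_linear.has_derivative[OF bounded_linear_vec_nth] has_derivative_ident)
qed

lemma continuous_on_measurement: "continuous_on S (\<lambda>z. measurement z k)"
  using measurement_has_derivative has_derivative_continuous
  by (metis continuous_at_imp_continuous_on)

text \<open>The measured values serve as coefficients of the gradients at \<open>q\<close>, so that
  \<open>g\<close> maps the space to itself and the inverse function theorem applies. The derivative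
  at \<open>q\<close> is injective because only 0 is orthogonal to a spanning family.\<close>

lemma measurement_chart:
  fixes q :: "real^'d::finite^'v::finite"
  assumes K: "indep_family (gradient q) K" "span (gradient q ` K) = UNIV" and U: "open U" "q \<in> U"
  defines "g \<equiv> \<lambda>z. \<Sum>k\<in>K. measurement z k *\<^sub>R gradient q k"
  shows "\<exists>W V \<gamma>. open W \<and> q \<in> W \<and> W \<subseteq> U \<and> open V \<and> homeomorphism W V g \<gamma>"
proof -
  define g' where "g' z = (\<Sum>k\<in>K. blinfun_scaleR_left (gradient q k) o\<^sub>L blinfun_inner_right (gradient z k))"
    for z :: "real^'d^'v"
  have g': "blinfun_apply (g' z) h = (\<Sum>k\<in>K. (gradient z k \<bullet> h) *\<^sub>R gradient q k)" for z h
    by (simp add: g'_def blinfun.sum_left)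
  have derg: "(g has_derivative blinfun_apply (g' z)) (at z)" for z
    unfolding g_def g'
    by (intro has_derivative_sum has_derivative_scaleR_left measurement_has_derivative)
  have contg: "continuous_on U g'"
    by (rule continuous_on_blinfun_componentwise)
       (simp only: g', intro continuous_intros continuous_on_gradient)
  have "inj (blinfun_apply (g' q))"
  proof (rule injI)
    fix h h' assume eq: "blinfun_apply (g' q) h = blinfun_apply (g' q) h'"
    have 0: "gradient q k \<bullet> (h - h') = 0" if "k \<in> K" for k
      using indep_family_eqD[OF K(1) eq[unfolded g'] that] by (simp add: inner_diff_right)
    have orth: "orthogonal (h - h') y" if "y \<in> gradient q ` K" for y
      using 0 that by (auto simp: orthogonal_def inner_commute[of "h - h'"])
    have "h - h' \<in> span (gradient q ` K)" unfolding K(2) by (rule UNIV_I)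
    then have "orthogonal (h - h') (h - h')" using orth by (rule orthogonal_to_span)
    then show "h = h'" by (simp add: orthogonal_self)
  qed
  then obtain l where l: "linear l" "l \<circ> blinfun_apply (g' q) = id"
    using linear_injective_left_inverse[of "blinfun_apply (g' q)"]
    by (auto simp: blinfun.bounded_linear_right bounded_linear.linear)
  have "Blinfun l o\<^sub>L g' q = id_blinfun"
    by (rule blinfun_eqI)
       (use l in \<open>simp add: bounded_linear_Blinfun_apply linear_conv_bounded_linear fun_eq_iff\<close>)
  from inverse_function_theorem[OF U(1) derg contg U(2) this] show ?thesis by metis
qed

text \<open>The coordinate functions have the standard basis as gradients, so they can complete any
  \<open>B\<close>.\<close>

lemma indep_family_extend_basis:
  fixes q :: "real^'d::finite^'v::finite"
  assumes "indep_family (gradient q) B"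
  obtains K where "B \<subseteq> K" "K \<subseteq> B \<union> range Inr" "indep_family (gradient q) K"
    "span (gradient q ` K) = UNIV"
proof -
  obtain K where K: "B \<subseteq> K" "K \<subseteq> B \<union> range Inr" "indep_family (gradient q) K"
    "gradient q ` (B \<union> range Inr) \<subseteq> span (gradient q ` K)"
    by (rule indep_family_extend[OF finite[of "B \<union> range Inr"] Un_upper1 assms])
  have "Basis \<subseteq> gradient q ` (B \<union> range Inr)"
  proof
    fix e :: "real^'d^'v" assume "e \<in> Basis"
    then obtain w i where "e = axis w (axis i 1)" by (auto simp: Basis_vec_def)
    then have "e = gradient q (Inr (w, i))" by (simp add: gradient_def)
    then show "e \<in> gradient q ` (B \<union> range Inr)" by blast
  qed
  with K(4) have "span Basis \<subseteq> span (gradient q ` K)"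
    by (intro span_minimal subspace_span) auto
  then have "span (gradient q ` K) = UNIV" by (simp add: top.extremum_unique)
  with K(1-3) show thesis by (rule that)
qed

lemma measurement_locally_surjective:
  fixes q :: "real^'d::finite^'v::finite"
  assumes B: "indep_family (gradient q) B" and U: "open U" "q \<in> U"
  shows "\<exists>\<epsilon>>0. \<forall>\<tau>. (\<forall>k\<in>B. \<bar>\<tau> k - measurement q k\<bar> < \<epsilon>) \<longrightarrow>
    (\<exists>z\<in>U. \<forall>k\<in>B. measurement z k = \<tau> k)"
proof -
  obtain K where K: "B \<subseteq> K" "indep_family (gradient q) K" "span (gradient q ` K) = UNIV"
    by (rule indep_family_extend_basis[OF B])
  define g where "g z = (\<Sum>k\<in>K. measurement z k *\<^sub>R gradient q k)" for z
  obtain W V \<gamma> where W: "open W" "q \<in> W" "W \<subseteq> U" "open V" "homeomorphism W V g \<gamma>"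
    using measurement_chart[OF K(2,3) U] unfolding g_def[abs_def] by (elim exE conjE)
  have "g q \<in> V" using W(2,5) by (auto simp: homeomorphism_def)
  then obtain \<delta> where \<delta>: "0 < \<delta>" "ball (g q) \<delta> \<subseteq> V"
    using W(4) open_contains_ball by blast
  \<comment> \<open>The summand 1 makes \<open>M\<close> positive and the estimate below
    strict.\<close>
  define M where "M = (\<Sum>k\<in>K. norm (gradient q k)) + 1"
  have M: "M > 0" unfolding M_def by (intro add_nonneg_pos sum_nonneg) auto
  show ?thesis
  proof (intro exI[of _ "\<delta> / M"] conjI allI impI)
    show "0 < \<delta> / M" using \<delta> M by simp
    fix \<tau> assume \<tau>: "\<forall>k\<in>B. \<bar>\<tau> k - measurement q k\<bar> < \<delta> / M"
    \<comment> \<open>The measurements that complete \<open>B\<close> to a chart keep their values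
      at \<open>q\<close>.\<close>
    define \<sigma> where "\<sigma> k = (if k \<in> B then \<tau> k else measurement q k)" for k
    have \<sigma>: "\<bar>\<sigma> k - measurement q k\<bar> \<le> \<delta> / M" for k
      using \<tau> \<delta> M by (auto simp: \<sigma>_def less_imp_le)
    define y where "y = (\<Sum>k\<in>K. \<sigma> k *\<^sub>R gradient q k)"
    have "norm (y - g q) = norm (\<Sum>k\<in>K. (\<sigma> k - measurement q k) *\<^sub>R gradient q k)"
      by (simp add: y_def g_def sum_subtractf scaleR_diff_left)
    also have "\<dots> \<le> (\<Sum>k\<in>K. \<delta> / M * norm (gradient q k))"
      by (rule sum_norm_le) (simp only: norm_scaleR mult_right_mono[OF \<sigma> norm_ge_zero])
    also have "\<dots> = \<delta> / M * (M - 1)" by (simp add: M_def sum_distrib_left)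
    also have "\<dots> < \<delta>" using \<delta> M by (simp add: field_simps)
    finally have "y \<in> V" using \<delta>(2) by (auto simp: dist_norm norm_minus_commute)
    then have "\<gamma> y \<in> W" "g (\<gamma> y) = y" using W(5) by (auto simp: homeomorphism_def)
    then have "measurement (\<gamma> y) k = \<sigma> k" if "k \<in> K" for k
      using indep_family_eqD[OF K(2) _ that, of "measurement (\<gamma> y)" \<sigma>] by (simp add: g_def y_def)
    moreover have "\<sigma> k = \<tau> k" if "k \<in> B" for k using that by (simp add: \<sigma>_def)
    ultimately show "\<exists>z\<in>U. \<forall>k\<in>B. measurement z k = \<tau> k"
      using K(1) W(3) \<open>\<gamma> y \<in> W\<close> by (intro bexI[of _ "\<gamma> y"]) auto
  qed
qed

text \<open>In a chart the fibre is the intersection of a ball with the affine subspace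
  \<open>T\<close>, which is convex; \<open>W'\<close> is the preimage of that ball.\<close>

lemma measurement_fibre_locally_connected:
  fixes q :: "real^'d::finite^'v::finite"
  assumes B: "indep_family (gradient q) B" and U: "open U" "q \<in> U"
  shows "\<exists>W. open W \<and> q \<in> W \<and> W \<subseteq> U \<and>
    connected {z\<in>W. \<forall>k\<in>B. measurement z k = measurement q k}"
proof -
  obtain K where K: "B \<subseteq> K" "indep_family (gradient q) K" "span (gradient q ` K) = UNIV"
    by (rule indep_family_extend_basis[OF B])
  define g where "g z = (\<Sum>k\<in>K. measurement z k *\<^sub>R gradient q k)" for z
  obtain W V \<gamma> where W: "open W" "q \<in> W" "W \<subseteq> U" "open V" "homeomorphism W V g \<gamma>"
    using measurement_chart[OF K(2,3) U] unfolding g_def[abs_def] by (elim exE conjE)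
  have hom: "\<gamma> ` V = W" "\<And>y. y \<in> V \<Longrightarrow> g (\<gamma> y) = y" "\<And>z. z \<in> W \<Longrightarrow> \<gamma> (g z) = z"
    "continuous_on V \<gamma>" "continuous_on W g" "g ` W = V"
    using W(5) by (auto simp: homeomorphism_def)
  have "g q \<in> V" using W(2) hom(6) by blast
  then obtain \<delta> where \<delta>: "0 < \<delta>" "ball (g q) \<delta> \<subseteq> V"
    using W(4) open_contains_ball by blast
  define W' where "W' = W \<inter> g -` ball (g q) \<delta>"
  have 1: "open W'" "q \<in> W'" "W' \<subseteq> U"
    using continuous_open_preimage[OF hom(5) W(1) open_ball] W(2,3) \<delta>(1) by (auto simp: W'_def)
  define T where "T = {y. \<exists>c. (\<forall>k\<in>B. c k = measurement q k) \<and> y = (\<Sum>k\<in>K. c k *\<^sub>R gradient q k)}"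
  have "convex T"
  proof (rule convexI)
    fix y y' and u v :: real assume "y \<in> T" "y' \<in> T" and uv: "u + v = 1"
    then obtain c c' where c: "\<forall>k\<in>B. c k = measurement q k" "y = (\<Sum>k\<in>K. c k *\<^sub>R gradient q k)"
      "\<forall>k\<in>B. c' k = measurement q k" "y' = (\<Sum>k\<in>K. c' k *\<^sub>R gradient q k)"
      by (auto simp: T_def)
    have "u *\<^sub>R y + v *\<^sub>R y' = (\<Sum>k\<in>K. (u * c k + v * c' k) *\<^sub>R gradient q k)"
      by (simp add: c scaleR_sum_right sum.distrib scaleR_add_left)
    moreover have "\<forall>k\<in>B. u * c k + v * c' k = measurement q k"
      using c(1,3) uv by (simp flip: distrib_right)
    ultimately show "u *\<^sub>R y + v *\<^sub>R y' \<in> T"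
      unfolding T_def by (intro CollectI exI[of _ "\<lambda>k. u * c k + v * c' k"]) simp
  qed
  then have "connected (ball (g q) \<delta> \<inter> T)"
    by (intro convex_connected convex_Int convex_ball)
  moreover have "continuous_on (ball (g q) \<delta> \<inter> T) \<gamma>"
    using hom(4) \<delta>(2) by (meson continuous_on_subset inf.coboundedI1)
  ultimately have "connected (\<gamma> ` (ball (g q) \<delta> \<inter> T))"
    by (intro connected_continuous_image)
  also have "\<gamma> ` (ball (g q) \<delta> \<inter> T) = {z\<in>W'. \<forall>k\<in>B. measurement z k = measurement q k}"
  proof (intro equalityI subsetI)
    fix z assume "z \<in> \<gamma> ` (ball (g q) \<delta> \<inter> T)"
    then obtain y where y: "y \<in> ball (g q) \<delta>" "y \<in> T" "z = \<gamma> y" by blast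
    then have yV: "y \<in> V" using \<delta>(2) by blast
    then have z: "z \<in> W" "g z = y" using y(3) hom(1,2) by auto
    obtain c where c: "\<forall>k\<in>B. c k = measurement q k" "y = (\<Sum>k\<in>K. c k *\<^sub>R gradient q k)"
      using y(2) by (auto simp: T_def)
    have "measurement z k = c k" if "k \<in> K" for k
      using indep_family_eqD[OF K(2) _ that, of "measurement z" c] z(2) c(2) by (simp add: g_def)
    then show "z \<in> {z\<in>W'. \<forall>k\<in>B. measurement z k = measurement q k}"
      using c(1) K(1) z y(1) by (auto simp: W'_def)
  next
    fix z assume z: "z \<in> {z\<in>W'. \<forall>k\<in>B. measurement z k = measurement q k}"
    then have "g z \<in> T" unfolding T_def g_def by blast
    with z show "z \<in> \<gamma> ` (ball (g q) \<delta> \<inter> T)"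
      using hom(3)[of z] by (intro image_eqI[of _ _ "g z"]) (auto simp: W'_def)
  qed
  finally show ?thesis using 1 by blast
qed

text \<open>Complement \<open>B\<close> by coordinates to a chart and choose the values of these coordinates
  independent over the common values of the measurements in \<open>B\<close>.\<close>

lemma fibre_contains_generic:
  fixes q :: "real^'d::finite^'v::finite"
  assumes B: "alg_independent_over_rat B (measurement q)" and U: "open U" "q \<in> U"
  shows "\<exists>z\<in>U. generic_config z \<and> (\<forall>k\<in>B. measurement z k = measurement q k)"
proof -
  obtain K where K: "B \<subseteq> K" "indep_family (gradient q) K" "span (gradient q ` K) = UNIV"
    by (rule indep_family_extend_basis[OF indep_gradient[OF B]])
  obtain \<epsilon> where \<epsilon>: "0 < \<epsilon>" "\<forall>\<tau>. (\<forall>k\<in>K. \<bar>\<tau> k - measurement q k\<bar> < \<epsilon>) \<longrightarrow>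
    (\<exists>z\<in>U. \<forall>k\<in>K. measurement z k = \<tau> k)"
    using measurement_locally_surjective[OF K(2) U] by blast
  obtain \<tau> where \<tau>: "\<forall>k. k \<notin> K - B \<longrightarrow> \<tau> k = measurement q k"
    "\<forall>k\<in>K - B. \<bar>\<tau> k - measurement q k\<bar> < \<epsilon>" "alg_independent_over_rat (B \<union> (K - B)) \<tau>"
    using ex_alg_independent_extension[OF finite[of "K - B"] finite[of B] _ B \<epsilon>(1), of "measurement q"]
    by blast
  have "\<bar>\<tau> k - measurement q k\<bar> < \<epsilon>" for k
    using \<tau>(1,2) \<epsilon>(1) by (cases "k \<in> K - B") auto
  then obtain z where z: "z \<in> U" "\<forall>k\<in>K. measurement z k = \<tau> k" using \<epsilon>(2) by blast
  have "alg_independent_over_rat K (measurement z)"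
    using \<tau>(3) K(1) z(2) alg_independent_cong[of K "measurement z" \<tau>] by (simp add: Un_absorb1)
  then have "generic_config z"
    using K(3) indep_family_card_iff[OF K(2)] by (intro generic_if_enough_measurements) auto
  moreover have "\<forall>k\<in>B. measurement z k = measurement q k"
    using z(2) \<tau>(1) K(1) by auto
  ultimately show ?thesis using z(1) by blast
qed

section \<open>Affine frames\<close>

text \<open>Polarized Leibniz formula: expand, using that the weights sum to 1. With
  \<open>a = b\<close> it expresses distances; with velocities as \<open>b\<close> it is the
  infinitesimal version.\<close>

lemma barycentric_inner:
  fixes a b :: "'k \<Rightarrow> 'a::real_inner"
  assumes "(\<Sum>m\<in>N. l m) = 1"
  shows "((\<Sum>m\<in>N. l m *\<^sub>R a m) - z) \<bullet> ((\<Sum>m\<in>N. l m *\<^sub>R b m) - w) =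
    (\<Sum>m\<in>N. l m * ((a m - z) \<bullet> (b m - w))) -
    (\<Sum>m\<in>N. \<Sum>k\<in>N. l m * l k * ((a m - a k) \<bullet> (b m - b k))) / 2"
proof -
  define A where "A m = a m - z" for m
  define B where "B m = b m - w" for m
  have A: "(\<Sum>m\<in>N. l m *\<^sub>R a m) - z = (\<Sum>m\<in>N. l m *\<^sub>R A m)"
    by (simp add: A_def scaleR_diff_right sum_subtractf assms flip: scaleR_sum_left)
  have B: "(\<Sum>m\<in>N. l m *\<^sub>R b m) - w = (\<Sum>m\<in>N. l m *\<^sub>R B m)"
    by (simp add: B_def scaleR_diff_right sum_subtractf assms flip: scaleR_sum_left)
  let ?X = "(\<Sum>m\<in>N. l m *\<^sub>R A m) \<bullet> (\<Sum>m\<in>N. l m *\<^sub>R B m)"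
  let ?Y = "\<Sum>m\<in>N. l m * (A m \<bullet> B m)"
  have X: "(\<Sum>m\<in>N. \<Sum>k\<in>N. l m * l k * (A m \<bullet> B k)) = ?X"
    by (subst sum.swap) (simp add: inner_sum_left inner_sum_right mult_ac sum_distrib_left)
  have X': "(\<Sum>m\<in>N. \<Sum>k\<in>N. l m * l k * (A k \<bullet> B m)) = ?X"
    unfolding X[symmetric] by (subst sum.swap) (simp add: mult_ac)
  have Y: "(\<Sum>m\<in>N. \<Sum>k\<in>N. l m * l k * (A m \<bullet> B m)) = ?Y"
  proof -
    have "(\<Sum>m\<in>N. \<Sum>k\<in>N. l m * l k * (A m \<bullet> B m)) = (\<Sum>m\<in>N. (l m * (A m \<bullet> B m)) * (\<Sum>k\<in>N. l k))"
      unfolding sum_distrib_left by (intro sum.cong refl) simp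
    then show ?thesis by (simp add: assms)
  qed
  have Y': "(\<Sum>m\<in>N. \<Sum>k\<in>N. l m * l k * (A k \<bullet> B k)) = ?Y"
    unfolding Y[symmetric] by (subst sum.swap) (simp add: mult_ac)
  have "(a m - a k) \<bullet> (b m - b k) = A m \<bullet> B m - A m \<bullet> B k - A k \<bullet> B m + A k \<bullet> B k" for m k
    by (simp add: A_def B_def inner_diff_left inner_diff_right)
  then have "(\<Sum>m\<in>N. \<Sum>k\<in>N. l m * l k * ((a m - a k) \<bullet> (b m - b k))) =
      (\<Sum>m\<in>N. \<Sum>k\<in>N. l m * l k * (A m \<bullet> B m) - l m * l k * (A m \<bullet> B k)
        - l m * l k * (A k \<bullet> B m) + l m * l k * (A k \<bullet> B k))"
    by (simp add: ring_distribs)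
  also have "\<dots> = ?Y - ?X - ?X + ?Y"
    by (simp only: sum.distrib sum_subtractf X X' Y Y')
  finally have "?X = ?Y - (\<Sum>m\<in>N. \<Sum>k\<in>N. l m * l k * ((a m - a k) \<bullet> (b m - b k))) / 2"
    by linarith
  then show ?thesis
    unfolding A B by (simp only: A_def B_def)
qed

lemma barycentric_norm:
  fixes a :: "'k \<Rightarrow> 'a::real_inner"
  assumes "(\<Sum>m\<in>N. l m) = 1"
  shows "(norm ((\<Sum>m\<in>N. l m *\<^sub>R a m) - z))\<^sup>2 = (\<Sum>m\<in>N. l m * (norm (a m - z))\<^sup>2) -
    (\<Sum>m\<in>N. \<Sum>k\<in>N. l m * l k * (norm (a m - a k))\<^sup>2) / 2"
  using barycentric_inner[OF assms, of a z a z] by (simp add: power2_norm_eq_inner)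

text \<open>The vertices of a full-dimensional simplex, with \<open>n\<close> as base point of the
  difference vectors.\<close>

definition affine_frame :: "('k \<Rightarrow> 'a::euclidean_space) \<Rightarrow> 'k \<Rightarrow> 'k set \<Rightarrow> bool" where
  "affine_frame a n N \<longleftrightarrow> n \<in> N \<and> card N = DIM('a) + 1 \<and> indep_family (\<lambda>m. a m - a n) (N - {n})"

lemma affine_frame_span:
  fixes a :: "'k \<Rightarrow> 'a::euclidean_space"
  assumes "affine_frame a n N"
  shows "span ((\<lambda>m. a m - a n) ` (N - {n})) = UNIV"
  using assms indep_family_card_iff[of "\<lambda>m. a m - a n" "N - {n}"]
  by (auto simp: affine_frame_def card_Diff_singleton)

lemma affine_frame_combination:
  fixes a :: "'k \<Rightarrow> 'a::euclidean_space"
  assumes "affine_frame a n N"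
  shows "\<exists>l. (\<Sum>m\<in>N. l m) = 1 \<and> y = (\<Sum>m\<in>N. l m *\<^sub>R a m)"
proof -
  let ?r = "\<lambda>m. a m - a n" and ?K = "N - {n}"
  have n: "n \<in> N" and inj: "inj_on ?r ?K" and "card N \<noteq> 0"
    using assms by (auto simp: affine_frame_def indep_family_def)
  then have fin: "finite N" by (cases "finite N") simp_all
  have "y - a n \<in> span (?r ` ?K)"
    unfolding affine_frame_span[OF assms] by (rule UNIV_I)
  then obtain c where "y - a n = (\<Sum>v\<in>?r ` ?K. c v *\<^sub>R v)"
    using fin by (auto simp: span_finite)
  then have c: "y - a n = (\<Sum>m\<in>?K. c (?r m) *\<^sub>R ?r m)"
    by (simp add: sum.reindex[OF inj])
  define l where "l m = (if m = n then 1 - (\<Sum>m\<in>?K. c (?r m)) else c (?r m))" for m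
  have l: "(\<Sum>m\<in>?K. l m) = (\<Sum>m\<in>?K. c (?r m))" "(\<Sum>m\<in>?K. l m *\<^sub>R a m) = (\<Sum>m\<in>?K. c (?r m) *\<^sub>R a m)"
    by (auto simp: l_def intro!: sum.cong)
  have "(\<Sum>m\<in>N. l m) = 1"
    using l(1) by (simp add: sum.remove[OF fin n] l_def[of n])
  moreover have "(\<Sum>m\<in>N. l m *\<^sub>R a m) = y"
  proof -
    have "y = a n + ((\<Sum>m\<in>?K. c (?r m) *\<^sub>R a m) - (\<Sum>m\<in>?K. c (?r m)) *\<^sub>R a n)"
      using c by (simp add: scaleR_diff_right sum_subtractf scaleR_sum_left algebra_simps)
    then show ?thesis
      by (simp add: sum.remove[OF fin n] l_def[of n] l(2) scaleR_diff_left)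
  qed
  ultimately show ?thesis by (intro exI[of _ l]) simp
qed

text \<open>By polarization the distances determine the Gram matrix of the difference vectors, and a
  linear combination vanishes exactly if its norm does.\<close>

lemma affine_frame_congruent:
  fixes a b :: "'k \<Rightarrow> 'a::euclidean_space"
  assumes a: "affine_frame a n N"
    and eq: "\<And>m k. m \<in> N \<Longrightarrow> k \<in> N \<Longrightarrow> norm (a m - a k) = norm (b m - b k)"
  shows "affine_frame b n N"
proof -
  have n: "n \<in> N" and ia: "indep_family (\<lambda>m. a m - a n) (N - {n})"
    using a by (auto simp: affine_frame_def)
  have pol: "v \<bullet> w = ((norm v)\<^sup>2 + (norm w)\<^sup>2 - (norm (v - w))\<^sup>2) / 2" for v w :: 'a
    by (simp add: power2_norm_eq_inner inner_diff_left inner_diff_right inner_commute)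
  have inner: "(a m - a n) \<bullet> (a k - a n) = (b m - b n) \<bullet> (b k - b n)" if "m \<in> N" "k \<in> N" for m k
    using that n by (simp add: pol eq)
  have "indep_family (\<lambda>m. b m - b n) (N - {n})"
    unfolding indep_family_iff[OF indep_family_finite[OF ia]]
  proof (intro allI impI ballI)
    fix c m assume 0: "(\<Sum>k\<in>N - {n}. c k *\<^sub>R (b k - b n)) = 0" and m: "m \<in> N - {n}"
    have "(\<Sum>k\<in>N - {n}. c k *\<^sub>R (a k - a n)) \<bullet> (\<Sum>k\<in>N - {n}. c k *\<^sub>R (a k - a n))
        = (\<Sum>k\<in>N - {n}. c k *\<^sub>R (b k - b n)) \<bullet> (\<Sum>k\<in>N - {n}. c k *\<^sub>R (b k - b n))"
      by (simp add: inner_sum_left inner_sum_right inner)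
    then have "(\<Sum>k\<in>N - {n}. c k *\<^sub>R (a k - a n)) = 0"
      unfolding 0 by simp
    from indep_familyD[OF ia this m] show "c m = 0" .
  qed
  with a show ?thesis by (simp add: affine_frame_def)
qed

text \<open>The determinant of the difference vectors is a polynomial in the coordinates, and it is
  nonzero when these vectors form the standard basis.\<close>

lemma generic_affine_frame:
  fixes z :: "real^'d::finite^'v::finite"
  assumes z: "generic_config z" and N: "card N = CARD('d) + 1" "n \<in> N"
  shows "affine_frame (($) z) n N"
proof -
  have "card (N - {n}) = card (UNIV :: 'd set)"
    using N by (simp add: card_Diff_singleton)
  then obtain \<sigma> :: "'d \<Rightarrow> 'v" where \<sigma>: "bij_betw \<sigma> UNIV (N - {n})"
    using finite_same_card_bij[of "UNIV :: 'd set" "N - {n}"] by auto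
  define M :: "real^'d^'v \<Rightarrow> real^'d^'d" where "M z = (\<chi> i. z $ \<sigma> i - z $ n)" for z
  have "rat_poly_fun coord (\<lambda>z. det (M z))"
  proof -
    have "det (M z) = (\<Sum>p\<in>{p. p permutes UNIV}. of_rat (of_int (sign p)) *
        (\<Prod>i\<in>UNIV. coord z (\<sigma> i, p i) - coord z (n, p i)))" for z
      by (simp add: det_def M_def coord_def)
    then show ?thesis
      by (simp only:) (intro rat_poly_fun_sum rat_poly_fun_mult rat_poly_fun_prod rat_poly_fun_diff
          rat_poly_fun_const rat_poly_fun_coord)
  qed
  moreover define z' :: "real^'d^'v" where
    "z' = (\<chi> w. if w = n then 0 else axis (the_inv_into UNIV \<sigma> w) 1)"
  have inj: "inj \<sigma>" and \<sigma>n: "\<sigma> i \<noteq> n" for i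
    using \<sigma> by (auto simp: bij_betw_def)
  have "M z' = mat 1"
    by (simp add: M_def z'_def \<sigma>n the_inv_into_f_f[OF inj] vec_eq_iff mat_def axis_def)
  then have "det (M z') \<noteq> 0" by simp
  ultimately have "det (M z) \<noteq> 0"
    using rat_poly_fun_eq_0[where c=coord and z=z and f="\<lambda>z. det (M z)" and z'=z'] z by blast
  then have rows: "\<forall>c. (\<Sum>i\<in>UNIV. c i *s row i (M z)) = 0 \<longrightarrow> (\<forall>i. c i = 0)"
    using invertible_det_nz[of "M z"]
    unfolding invertible_right_inverse matrix_right_invertible_independent_rows by blast
  have "indep_family (\<lambda>m. z $ m - z $ n) (N - {n})"
    unfolding indep_family_iff[OF finite[of "N - {n}"]]
  proof (intro allI impI ballI)
    fix c m assume 0: "(\<Sum>m\<in>N - {n}. c m *\<^sub>R (z $ m - z $ n)) = 0" and m: "m \<in> N - {n}"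
    have "(\<Sum>i\<in>UNIV. c (\<sigma> i) *s row i (M z)) = (\<Sum>i\<in>UNIV. c (\<sigma> i) *\<^sub>R (z $ \<sigma> i - z $ n))"
      by (simp add: row_def M_def scalar_mult_eq_scaleR vec_lambda_eta flip: vector_minus_component)
    also have "\<dots> = 0"
      using 0 sum.reindex_bij_betw[OF \<sigma>, of "\<lambda>m. c m *\<^sub>R (z $ m - z $ n)"] by simp
    finally have "c (\<sigma> i) = 0" for i
      using rows[rule_format, of "\<lambda>i. c (\<sigma> i)"] by blast
    moreover obtain i where "m = \<sigma> i" using \<sigma> m by (auto simp: bij_betw_def)
    ultimately show "c m = 0" by simp
  qed
  with N show ?thesis by (simp add: affine_frame_def)
qed

text \<open>The bisector of \<open>0\<close> and \<open>V\<close> is the hyperplane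
  \<open>a \<bullet> w = 1/2\<close>, where \<open>a\<close> is the inverse of \<open>V\<close> in
  the unit sphere; likewise \<open>b\<close> for \<open>W\<close>. If \<open>b\<close> is no longer
  than \<open>a\<close> and differs from it, then \<open>b \<bullet> a < a \<bullet> a\<close>, so a
  multiple of \<open>a\<close> lies beyond one hyperplane only.\<close>

lemma between_bisectors_aux:
  fixes V W :: "'a::real_inner"
  assumes "V \<noteq> 0" "W \<noteq> 0" "V \<noteq> W" and le: "norm (W /\<^sub>R (norm W)\<^sup>2) \<le> norm (V /\<^sub>R (norm V)\<^sup>2)"
  shows "\<exists>w. ((norm V)\<^sup>2 - 2 * (V \<bullet> w)) * ((norm W)\<^sup>2 - 2 * (W \<bullet> w)) < 0"
proof -
  define a where "a = V /\<^sub>R (norm V)\<^sup>2"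
  define b where "b = W /\<^sub>R (norm W)\<^sup>2"
  have V: "V = (norm V)\<^sup>2 *\<^sub>R a" and W: "W = (norm W)\<^sup>2 *\<^sub>R b"
    using assms by (simp_all add: a_def b_def)
  have na: "norm a = 1 / norm V" and nb: "norm b = 1 / norm W"
    using assms by (simp_all add: a_def b_def power2_eq_square divide_simps)
  have "a \<noteq> b"
  proof
    assume ab: "a = b"
    then have "norm V = norm W" using na nb assms by (simp add: field_simps)
    then show False using V W ab \<open>V \<noteq> W\<close> by metis
  qed
  define \<alpha> where "\<alpha> = a \<bullet> a"
  define \<beta> where "\<beta> = b \<bullet> a"
  have "\<alpha> > 0" using assms(1) by (simp add: \<alpha>_def a_def)
  have "\<beta> < \<alpha>"
  proof -
    have "0 < (a - b) \<bullet> (a - b)" using \<open>a \<noteq> b\<close> by simp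
    also have "\<dots> = \<alpha> - 2 * \<beta> + b \<bullet> b"
      by (simp add: \<alpha>_def \<beta>_def inner_diff_left inner_diff_right inner_commute)
    also have "b \<bullet> b \<le> \<alpha>"
      using le unfolding \<alpha>_def a_def[symmetric] b_def[symmetric] by (simp add: norm_le)
    finally show ?thesis by simp
  qed
  \<comment> \<open>For positive \<open>\<beta>\<close> the products become
    \<open>\<alpha> / (\<alpha> + \<beta>)\<close> and
    \<open>\<beta> / (\<alpha> + \<beta>)\<close>, on either side of 1/2.\<close>
  obtain s where s: "s * \<alpha> > 1/2" "s * \<beta> < 1/2"
  proof (cases "\<beta> \<le> 0")
    case True
    then show thesis
      using \<open>\<alpha> > 0\<close> by (intro that[of "1 / \<alpha>"]) (auto simp: divide_nonpos_pos order.strict_trans1)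
  next
    case False
    then show thesis
      using \<open>\<alpha> > 0\<close> \<open>\<beta> < \<alpha>\<close> by (intro that[of "1 / (\<alpha> + \<beta>)"]) (auto simp: field_simps)
  qed
  have "(norm V)\<^sup>2 - 2 * (V \<bullet> (s *\<^sub>R a)) = (norm V)\<^sup>2 * (1 - 2 * (s * \<alpha>))"
    by (subst (2) V) (simp add: \<alpha>_def algebra_simps)
  moreover have "(norm W)\<^sup>2 - 2 * (W \<bullet> (s *\<^sub>R a)) = (norm W)\<^sup>2 * (1 - 2 * (s * \<beta>))"
    by (subst (2) W) (simp add: \<beta>_def algebra_simps)
  moreover have "(norm V)\<^sup>2 * (1 - 2 * (s * \<alpha>)) < 0" "(norm W)\<^sup>2 * (1 - 2 * (s * \<beta>)) > 0"
    using s assms by (simp_all add: mult_pos_neg)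
  ultimately show ?thesis by (intro exI[of _ "s *\<^sub>R a"]) (simp add: mult_neg_pos)
qed

text \<open>Some point lies strictly on different sides of the bisectors of \<open>z, x\<^sub>0\<close> and of
  \<open>z, x\<^sub>1\<close> (relative to \<open>z\<close>), because these bisectors differ.\<close>

lemma between_bisectors:
  fixes z x0 x1 :: "'a::real_inner"
  assumes "x0 \<noteq> z" "x1 \<noteq> z" "x0 \<noteq> x1"
  shows "\<exists>y. ((norm (x0 - y))\<^sup>2 - (norm (z - y))\<^sup>2) * ((norm (x1 - y))\<^sup>2 - (norm (z - y))\<^sup>2) < 0"
proof -
  define V where "V = x0 - z"
  define W where "W = x1 - z"
  have nz: "V \<noteq> 0" "W \<noteq> 0" "V \<noteq> W" "W \<noteq> V" using assms by (auto simp: V_def W_def)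
  have "\<exists>w. ((norm V)\<^sup>2 - 2 * (V \<bullet> w)) * ((norm W)\<^sup>2 - 2 * (W \<bullet> w)) < 0"
  proof (cases "norm (W /\<^sub>R (norm W)\<^sup>2) \<le> norm (V /\<^sub>R (norm V)\<^sup>2)")
    case True
    then show ?thesis using nz by (intro between_bisectors_aux)
  next
    case False
    then have "\<exists>w. ((norm W)\<^sup>2 - 2 * (W \<bullet> w)) * ((norm V)\<^sup>2 - 2 * (V \<bullet> w)) < 0"
      using nz by (intro between_bisectors_aux) auto
    then show ?thesis by (subst mult.commute)
  qed
  then obtain w where w: "((norm V)\<^sup>2 - 2 * (V \<bullet> w)) * ((norm W)\<^sup>2 - 2 * (W \<bullet> w)) < 0" ..
  have "(norm (v - (z + w)))\<^sup>2 - (norm (z - (z + w)))\<^sup>2 = (norm (v - z))\<^sup>2 - 2 * ((v - z) \<bullet> w)" for v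
    by (simp add: power2_norm_eq_inner inner_diff_left inner_diff_right inner_add_left
        inner_add_right inner_commute)
  then show ?thesis
    using w by (intro exI[of _ "z + w"]) (simp only: V_def W_def)
qed

text \<open>Double orthogonal complement; membership in a row space can thus be tested on
  infinitesimal motions.\<close>

lemma in_span_if_orthogonal:
  fixes v :: "'a::euclidean_space"
  assumes "\<And>h. (\<And>s. s \<in> S \<Longrightarrow> s \<bullet> h = 0) \<Longrightarrow> v \<bullet> h = 0"
  shows "v \<in> span S"
proof -
  obtain a b where ab: "a \<in> span S" "\<And>w. w \<in> span S \<Longrightarrow> orthogonal b w" "v = a + b"
    using orthogonal_subspace_decomp_exists[of S v] by blast
  have "v \<bullet> b = 0"
    using ab(2) span_base by (intro assms) (auto simp: orthogonal_def inner_commute[of b])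
  moreover have "a \<bullet> b = 0"
    using ab(2)[OF ab(1)] by (simp add: orthogonal_def inner_commute[of b])
  ultimately have "b \<bullet> b = 0" unfolding ab(3) inner_add_left by simp
  then show ?thesis using ab by simp
qed

text \<open>Infinitesimal version of: a point is determined by its distances to an affine frame.\<close>

lemma rigidity_row_in_span:
  fixes P :: "'v::finite \<Rightarrow> real^'d::finite"
  assumes F: "affine_frame P n N"
    and S: "\<And>m k. m \<in> N \<Longrightarrow> k \<in> N \<Longrightarrow> m \<noteq> k \<Longrightarrow> rigidity_row P m k \<in> span S"
      "\<And>m. m \<in> N \<Longrightarrow> rigidity_row P x m \<in> span S" "\<And>m. m \<in> N \<Longrightarrow> rigidity_row P y m \<in> span S"
  shows "rigidity_row P x y \<in> span S"
proof (rule in_span_if_orthogonal)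
  fix h assume "\<And>s. s \<in> S \<Longrightarrow> s \<bullet> h = 0"
  then have orth: "s \<bullet> h = 0" if "s \<in> span S" for s
    using orthogonal_to_span[OF that, of h] by (auto simp: orthogonal_def inner_commute)
  have flex: "(P m - P k) \<bullet> (h $ m - h $ k) = 0" if "m \<in> N" "k \<in> N" for m k
    using orth[OF S(1)[OF that]] by (cases "m = k") (auto simp: inner_rigidity_row)
  have flexx: "(P m - P x) \<bullet> (h $ m - h $ x) = 0" and flexy: "(P m - P y) \<bullet> (h $ m - h $ y) = 0"
    if "m \<in> N" for m
    using orth[OF S(2)[OF that]] orth[OF S(3)[OF that]]
    by (simp_all add: inner_rigidity_row algebra_simps)
  obtain l where l: "(\<Sum>m\<in>N. l m) = 1" "P y = (\<Sum>m\<in>N. l m *\<^sub>R P m)"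
    using affine_frame_combination[OF F] by blast
  \<comment> \<open>The velocity that the frame forces at \<open>P y\<close> through its barycentric
    coordinates. Once \<open>w = h $ y\<close> is known, \<open>id\<close> at \<open>x\<close> gives
    the claim.\<close>
  define w where "w = (\<Sum>m\<in>N. l m *\<^sub>R h $ m)"
  have id: "(P y - P k) \<bullet> (w - h $ k) = 0" if "\<And>m. m \<in> N \<Longrightarrow> (P m - P k) \<bullet> (h $ m - h $ k) = 0" for k
    using barycentric_inner[OF l(1), of P "P k" "($) h" "h $ k"] that flex
    by (simp add: l(2) w_def)
  have 0: "(P y - P k) \<bullet> (w - h $ y) = 0" if "k \<in> N" for k
  proof -
    have "(P y - P k) \<bullet> (w - h $ k) = 0" by (rule id) (rule flex[OF _ that])
    moreover have "(P y - P k) \<bullet> (h $ y - h $ k) = 0"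
      using flexy[OF that] by (simp add: algebra_simps)
    ultimately show ?thesis by (simp add: algebra_simps)
  qed
  have orth': "orthogonal (w - h $ y) v" if v: "v \<in> (\<lambda>m. P m - P n) ` (N - {n})" for v
  proof -
    obtain m where m: "m \<in> N" "v = P m - P n" using v by auto
    have "n \<in> N" using F by (simp add: affine_frame_def)
    from 0[OF m(1)] 0[OF this] have "v \<bullet> (w - h $ y) = 0"
      by (simp add: m(2) inner_diff_left)
    then show ?thesis by (simp add: orthogonal_def inner_commute)
  qed
  have "w - h $ y \<in> span ((\<lambda>m. P m - P n) ` (N - {n}))"
    unfolding affine_frame_span[OF F] by (rule UNIV_I)
  then have "orthogonal (w - h $ y) (w - h $ y)" using orth' by (rule orthogonal_to_span)
  then have "w = h $ y" by (simp add: orthogonal_self)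
  then have "(P y - P x) \<bullet> (h $ y - h $ x) = 0" using id[of x] flexx by simp
  then show "rigidity_row P x y \<bullet> h = 0"
    by (simp add: inner_rigidity_row algebra_simps)
qed

section \<open>Proof of the theorem\<close>

lemma generic_if_generic_config:
  assumes "generic_config z" "\<And>w. w \<in> X \<Longrightarrow> p w = z $ w"
  shows "generic X p"
  unfolding generic_def
proof (subst alg_independent_cong)
  show "(case c of (w, i) \<Rightarrow> p w $ i) = coord z c" if "c \<in> X \<times> UNIV" for c
    using that assms(2) by (auto simp: coord_def)
  show "alg_independent_over_rat (X \<times> UNIV) (coord z)"
    using assms(1) by (rule alg_independent_mono) simp
qed

text \<open>Filling in the vertices outside \<open>X\<close> lets genericity refer to all
  coordinates from here on; the target \<open>r\<close> also serves to place a vertex in a given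
  open set.\<close>

lemma ex_generic_config:
  fixes p :: "'v::finite \<Rightarrow> real^'d::finite"
  assumes "generic X p" "0 < \<epsilon>"
  shows "\<exists>z. generic_config z \<and> (\<forall>w\<in>X. z $ w = p w) \<and> (\<forall>w. w \<notin> X \<longrightarrow> norm (z $ w - r w) < \<epsilon>)"
proof -
  let ?I = "X \<times> (UNIV :: 'd set)"
  \<comment> \<open>Each of the \<open>CARD('d)\<close> coordinates adds less than
    \<open>\<delta>\<close> to the l1 norm.\<close>
  define \<delta> where "\<delta> = \<epsilon> / CARD('d)"
  have "0 < \<delta>" using assms(2) by (simp add: \<delta>_def)
  obtain t where t: "\<forall>k. k \<notin> - ?I \<longrightarrow> t k = (case k of (w, i) \<Rightarrow> p w $ i)"
    "\<forall>k\<in>- ?I. \<bar>t k - (case k of (w, i) \<Rightarrow> r w $ i)\<bar> < \<delta>" "alg_independent_over_rat (?I \<union> - ?I) t"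
    using ex_alg_independent_extension[OF finite finite Compl_disjoint
        assms(1)[unfolded generic_def] \<open>0 < \<delta>\<close>, of "\<lambda>(w, i). r w $ i"] by blast
  define z where "z = (\<chi> w i. t (w, i))"
  have "coord z = t" by (auto simp: coord_def z_def)
  then have "generic_config z" using t(3) unfolding Compl_partition by simp
  moreover have "z $ w = p w" if "w \<in> X" for w
    using t(1) that by (simp add: z_def vec_eq_iff)
  moreover have "norm (z $ w - r w) < \<epsilon>" if "w \<notin> X" for w
  proof -
    have "norm (z $ w - r w) \<le> (\<Sum>i\<in>UNIV. \<bar>(z $ w - r w) $ i\<bar>)" by (rule norm_le_l1_cart)
    also have "\<dots> < (\<Sum>i\<in>(UNIV :: 'd set). \<delta>)"
      using t(2) that by (intro sum_strict_mono) (auto simp: z_def)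
    also have "\<dots> = \<epsilon>" by (simp add: \<delta>_def)
    finally show ?thesis .
  qed
  ultimately show ?thesis by blast
qed

text \<open>The image is connected and, by dependence on \<open>B\<close>, finite, hence a single
  point.\<close>

lemma measurement_constant_on_connected_fibre:
  assumes z0: "generic_config z0" and dep: "\<not> alg_independent_over_rat (insert e B) (measurement z0)"
    and ind: "alg_independent_over_rat B (measurement q)" and conn: "connected S"
    and S: "\<And>s k. s \<in> S \<Longrightarrow> k \<in> B \<Longrightarrow> measurement s k = measurement q k"
    and st: "s \<in> S" "t \<in> S"
  shows "measurement s e = measurement t e"
proof -
  let ?f = "\<lambda>s. measurement s e"
  have "finite (?f ` S)"
    by (rule dependent_value_finite[where c=coord, OF z0 rat_poly_fun_measurement dep ind S])
  moreover have "connected (?f ` S)"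
    using conn by (intro connected_continuous_image continuous_on_measurement)
  ultimately have "?f ` S = {} \<or> (\<exists>a. ?f ` S = {a})"
    using connected_finite_iff_sing by blast
  then show ?thesis using st by (metis empty_iff imageI singletonD)
qed

text \<open>Independent gradients allow measurement \<open>e\<close> to be raised slightly while
  those in \<open>B\<close> stay fixed.\<close>

lemma measurement_nonconstant_on_fibre:
  assumes W: "open W" "z \<in> W" and ind: "indep_family (gradient z) (insert e B)" and e: "e \<notin> B"
  shows "\<exists>s\<in>W. (\<forall>k\<in>B. measurement s k = measurement z k) \<and> measurement s e \<noteq> measurement z e"
proof -
  obtain \<epsilon> where \<epsilon>: "0 < \<epsilon>" "\<forall>\<tau>. (\<forall>k\<in>insert e B. \<bar>\<tau> k - measurement z k\<bar> < \<epsilon>) \<longrightarrow>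
    (\<exists>s\<in>W. \<forall>k\<in>insert e B. measurement s k = \<tau> k)"
    using measurement_locally_surjective[OF ind W] by blast
  define \<tau> where "\<tau> k = (if k = e then measurement z e + \<epsilon> / 2 else measurement z k)" for k
  have "\<forall>k\<in>insert e B. \<bar>\<tau> k - measurement z k\<bar> < \<epsilon>"
    using \<epsilon>(1) by (auto simp: \<tau>_def)
  then obtain s where "s \<in> W" "\<forall>k\<in>insert e B. measurement s k = \<tau> k"
    using \<epsilon>(2) by blast
  then show ?thesis
    using \<epsilon>(1) e by (intro bexI[of _ s]) (auto simp: \<tau>_def)
qed

text \<open>At generic points independent rows and independent lengths are the same, and the latter
  transfer. The case \<open>e \<in> B\<close> is separate, as then \<open>insert e B\<close> is just
  \<open>B\<close>.\<close>

lemma gradient_in_span_transfer: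
  assumes z: "generic_config z" and P: "generic_config P"
    and B: "alg_independent_over_rat B (measurement z)"
    and e: "e \<in> B \<or> \<not> indep_family (gradient z) (insert e B)"
  shows "gradient P e \<in> span (gradient P ` B)"
proof (cases "e \<in> B")
  case True
  then show ?thesis by (intro span_base imageI)
next
  case False
  show ?thesis
  proof (rule ccontr)
    assume "gradient P e \<notin> span (gradient P ` B)"
    moreover have "indep_family (gradient P) B"
      by (rule indep_gradient, rule alg_independent_transfer[where c=coord, OF P rat_poly_fun_measurement B])
    ultimately have "indep_family (gradient P) (insert e B)"
      by (simp add: indep_family_insert[OF False])
    then have "alg_independent_over_rat (insert e B) (measurement P)"
      by (rule alg_independent_measurement[OF P])
    then have "alg_independent_over_rat (insert e B) (measurement z)"
      by (rule alg_independent_transfer[where c=coord, OF z rat_poly_fun_measurement])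
    then show False using e False indep_gradient by blast
  qed
qed

text \<open>Two values make the connected image infinite, so two still remain after discarding
  0.\<close>

lemma connected_two_nonzero_values:
  fixes f :: "'a::topological_space \<Rightarrow> real"
  assumes "connected S" "continuous_on S f" "s \<in> S" "t \<in> S" "f s \<noteq> f t"
  shows "\<exists>a\<in>S. \<exists>b\<in>S. f a \<noteq> 0 \<and> f b \<noteq> 0 \<and> f a \<noteq> f b"
proof -
  define J where "J = f ` S"
  have J: "connected J" "f s \<in> J" "f t \<in> J"
    using assms by (auto simp: J_def intro: connected_continuous_image)
  have "infinite J"
  proof
    assume "finite J"
    then have "J = {} \<or> (\<exists>a. J = {a})" using J(1) connected_finite_iff_sing by blast
    then show False using J(2,3) assms(5) by auto
  qed
  then have "infinite (J - {0})" by simp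
  then obtain a where a: "a \<in> J - {0}"
    using infinite_imp_nonempty by blast
  have "infinite (J - {0} - {a})" using \<open>infinite (J - {0})\<close> by simp
  then obtain b where b: "b \<in> J - {0} - {a}" using infinite_imp_nonempty by blast
  show ?thesis using a b unfolding J_def by force
qed

lemma rigidity_row_commute: "rigidity_row p a b = rigidity_row p b a"
  by (simp add: rigidity_row_def vec_eq_iff)

lemma gradient_eq_rigidity_row:
  assumes "z $ a = p a" "z $ b = p b"
  shows "gradient z (Inl (a, b)) = 2 *\<^sub>R rigidity_row p a b"
  using assms by (simp add: gradient_def rigidity_row_def cong: if_cong)

lemma not_bridge_if_in_span:
  assumes xy: "{x, y} \<in> E" and P: "P = (SOME p :: 'v::finite \<Rightarrow> real^'d::finite. generic V p)"
    and span: "rigidity_row P x y \<in> span (rigidity_rows (E - {{x, y}}) P)"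
  shows "\<not> rigidity_bridge TYPE('d) V E {x, y}"
proof
  assume "rigidity_bridge TYPE('d) V E {x, y}"
  then have rank: "dim (rigidity_rows (E - {{x, y}}) P) + 1 = dim (rigidity_rows E P)"
    by (simp add: rigidity_bridge_def rigidity_rank_def P)
  have "rigidity_rows E P \<subseteq> span (rigidity_rows (E - {{x, y}}) P)"
  proof
    fix r assume "r \<in> rigidity_rows E P"
    then obtain a b where ab: "{a, b} \<in> E" "r = rigidity_row P a b" by (auto simp: rigidity_rows_def)
    show "r \<in> span (rigidity_rows (E - {{x, y}}) P)"
    proof (cases "{a, b} = {x, y}")
      case True
      then have "r = rigidity_row P x y"
        using ab(2) rigidity_row_commute[of P x y] by (auto simp: doubleton_eq_iff)
      then show ?thesis using span by simp
    next
      case False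
      with ab have "r \<in> rigidity_rows (E - {{x, y}}) P" unfolding rigidity_rows_def by blast
      then show ?thesis by (rule span_base)
    qed
  qed
  then have "dim (rigidity_rows E P) \<le> dim (rigidity_rows (E - {{x, y}}) P)"
    by (metis dim_span dim_subset)
  with rank show False by simp
qed

lemma card_neighbours_ge:
  assumes "simple_graph V E" "vertex_degree E y \<ge> n + 2"
  shows "card (neighbours E y - {x :: 'v::finite}) \<ge> n + 1"
proof -
  have "{e \<in> E. y \<in> e} \<subseteq> (\<lambda>w. {y, w}) ` neighbours E y"
  proof
    fix e assume e: "e \<in> {e \<in> E. y \<in> e}"
    then have "card e = 2" using assms(1) by (auto simp: simple_graph_def)
    then obtain a b where "e = {a, b}" by (auto simp: card_2_iff)
    with e have "e = {y, a} \<or> e = {y, b}" by auto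
    then show "e \<in> (\<lambda>w. {y, w}) ` neighbours E y"
      using e by (auto simp: neighbours_def)
  qed
  then have "vertex_degree E y \<le> card (neighbours E y)"
    unfolding vertex_degree_def by (rule surj_card_le[OF finite])
  then show ?thesis
    using assms(2) by (cases "x \<in> neighbours E y") (auto simp: card_Diff_singleton)
qed

theorem theorem4p3:
  fixes V :: "'v::finite set" and E :: "'v set set" and x y u v :: 'v
  assumes "simple_graph V E"
    and "rigid_graph TYPE('d::finite) V E"
    and "{x, y} \<in> E"
    and "rigidity_bridge TYPE('d) V E {x, y}"
    and "vertex_degree E y \<ge> CARD('d) + 2"
    and "pairwise (globally_linked TYPE('d) (V - {y}) (edges_avoiding E y))
           (neighbours E y - {x})"
    and "u \<in> V" and "v \<in> V" and "u \<noteq> v" and "y \<notin> {u, v}"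
    and "\<not> globally_linked TYPE('d) (V - {y}) (edges_avoiding E y) u v"
  shows "\<not> globally_linked TYPE('d) V E u v"
proof -
  define V' where "V' = V - {y}"
  define E' where "E' = edges_avoiding E y"
  define N where "N = neighbours E y - {x}"
  have edge: "a \<in> V" "b \<in> V" "a \<noteq> b" if "{a, b} \<in> E" for a b
    using assms(1) that by (auto simp: simple_graph_def)
  have E': "{a, b} \<in> E' \<longleftrightarrow> {a, b} \<in> E \<and> a \<noteq> y \<and> b \<noteq> y" for a b
    by (auto simp: E'_def edges_avoiding_def)
  have E'V': "a \<in> V'" "b \<in> V'" if "{a, b} \<in> E'" for a b
    using that edge[of a b] by (auto simp: E' V'_def)
  have N: "{y, m} \<in> E" "m \<noteq> y" "m \<noteq> x" "m \<in> V'" if "m \<in> N" for m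
    using that edge[of y m] by (auto simp: N_def neighbours_def V'_def)
  have "x \<noteq> y" using edge(3)[OF assms(3)] by simp

  \<comment> \<open>A violating pair of realizations of \<open>G - y\<close> and a basis of its
    rigidity matroid\<close>
  obtain p0 q0 :: "'v \<Rightarrow> real^'d" where p0: "generic V' p0" and q0: "equivalent_frameworks E' p0 q0"
    and uv0: "norm (q0 u - q0 v) \<noteq> norm (p0 u - p0 v)"
    using assms(11) unfolding globally_linked_def globally_linked_in_framework_def V'_def E'_def by blast
  obtain p :: "real^'d^'v" where p: "generic_config p" and pp0: "\<forall>w\<in>V'. p $ w = p0 w"
    using ex_generic_config[OF p0 zero_less_one] by blast
  define q where "q = (\<chi> w. q0 w)"
  \<comment> \<open>Edges are listed in both orientations; independence lets \<open>B\<close>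
    contain at most one of the two.\<close>
  define D :: "('v \<times> 'v + 'v \<times> 'd) set" where "D = Inl ` {(a, b). {a, b} \<in> E'}"
  have qD: "measurement q k = measurement p k" if "k \<in> D" for k
  proof -
    obtain a b where k: "k = Inl (a, b)" "{a, b} \<in> E'" using \<open>k \<in> D\<close> by (auto simp: D_def)
    then have "norm (p $ a - p $ b) = norm (q $ a - q $ b)"
      using q0 pp0 E'V'[OF k(2)] by (simp add: equivalent_frameworks_def q_def)
    then show ?thesis by (simp add: k measurement_def)
  qed
  obtain B where B: "B \<subseteq> D" "indep_family (gradient p) B" "gradient p ` D \<subseteq> span (gradient p ` B)"
    by (rule indep_family_extend[OF finite[of D] empty_subsetI, of "gradient p"])
       (simp add: indep_family_iff[OF finite.emptyI])
  have Bp: "alg_independent_over_rat B (measurement p)"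
    by (rule alg_independent_measurement[OF p B(2)])
  \<comment> \<open>Independence depends only on the measured values, and these agree at
    \<open>p\<close> and \<open>q\<close>.\<close>
  have Bq: "alg_independent_over_rat B (measurement q)"
    using Bp alg_independent_cong[of B "measurement q" "measurement p"] qD B(1) by blast

  \<comment> \<open>The connected fibre \<open>S\<close> through \<open>q\<close>\<close>
  let ?uv = "Inl (u, v) :: ('v \<times> 'v) + ('v \<times> 'd)"
  \<comment> \<open>An open condition that holds at \<open>q\<close>; via
    \<open>W \<subseteq> U\<close> the distance of \<open>u\<close> and \<open>v\<close> differs
    from that in \<open>p\<close> on all of \<open>S\<close>.\<close>
  define U where "U = {z. measurement z ?uv \<noteq> measurement p ?uv}"
  have "open U"
    unfolding U_def by (intro open_Collect_neq continuous_on_measurement continuous_on_const)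
  moreover have "u \<in> V'" "v \<in> V'" using assms(7,8,10) by (auto simp: V'_def)
  then have "q \<in> U"
    using uv0 pp0 by (simp add: U_def measurement_def q_def)
  ultimately obtain W where W: "open W" "q \<in> W" "W \<subseteq> U"
    and conn: "connected {z\<in>W. \<forall>k\<in>B. measurement z k = measurement q k}"
    using measurement_fibre_locally_connected[OF indep_gradient[OF Bq]] by blast
  define S where "S = {z\<in>W. \<forall>k\<in>B. measurement z k = measurement q k}"
  have conn: "connected S" using conn by (simp only: S_def)
  have "q \<in> S" using W(2) by (simp add: S_def)
  have SB: "measurement s k = measurement q k" if "s \<in> S" "k \<in> B" for s k
    using that by (simp add: S_def)

  \<comment> \<open>Outside \<open>B\<close> the gradient at \<open>p\<close> is dependent, so the
    length is algebraically dependent on those in \<open>B\<close> and constant on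
    \<open>S\<close>.\<close>
  have SD: "measurement s k = measurement p k" if s: "s \<in> S" and k: "k \<in> D" for s k
  proof -
    have "measurement s k = measurement q k"
    proof (cases "k \<in> B")
      case False
      have "gradient p k \<in> span (gradient p ` B)" using B(3) k by blast
      then have "\<not> indep_family (gradient p) (insert k B)"
        by (simp add: indep_family_insert[OF False])
      then have "\<not> alg_independent_over_rat (insert k B) (measurement p)"
        using indep_gradient by blast
      from measurement_constant_on_connected_fibre[OF p this Bq conn SB s \<open>q \<in> S\<close>]
      show ?thesis by simp
    qed (rule SB[OF s])
    then show ?thesis using qD[OF k] by simp
  qed
  have Sequiv: "norm (p $ a - p $ b) = norm (s $ a - s $ b)" if "s \<in> S" "{a, b} \<in> E'" for s a b
  proof -
    have "Inl (a, b) \<in> D" using that(2) by (auto simp: D_def)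
    from SD[OF that(1) this] show ?thesis by (simp add: measurement_def)
  qed
  have SN: "norm (p $ m - p $ k) = norm (s $ m - s $ k)" if "s \<in> S" "m \<in> N" "k \<in> N" for s m k
  proof (cases "m = k")
    case False
    then have "globally_linked TYPE('d) V' E' m k"
      using assms(6) that(2,3) by (auto simp: pairwise_def N_def V'_def E'_def)
    moreover have "generic V' (($) p)" using p by (rule generic_if_generic_config) simp
    moreover have "equivalent_frameworks E' (($) p) (($) s)"
      using Sequiv[OF that(1)] by (simp add: equivalent_frameworks_def)
    ultimately show ?thesis
      unfolding globally_linked_def globally_linked_in_framework_def by metis
  qed simp

  \<comment> \<open>The vertex \<open>x\<close> moves relative to the other neighbours of
    \<open>y\<close>\<close>
  have "card N \<ge> CARD('d) + 1"
    unfolding N_def by (rule card_neighbours_ge[OF assms(1,5)])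
  then obtain M where M: "M \<subseteq> N" "card M = CARD('d) + 1"
    by (meson obtain_subset_with_card_n)
  then obtain n where n: "n \<in> M" by (metis add_is_0 card.empty ex_in_conv one_neq_zero)
  have frame: "affine_frame (($) z) n M" if "generic_config z" for z :: "real^'d^'v"
    using that M(2) n by (rule generic_affine_frame)

  have "\<exists>m\<in>M. \<exists>s\<in>S. \<exists>t\<in>S. measurement s (Inl (x, m)) \<noteq> measurement t (Inl (x, m))"
  proof (rule ccontr)
    assume "\<not> (\<exists>m\<in>M. \<exists>s\<in>S. \<exists>t\<in>S. measurement s (Inl (x, m)) \<noteq> measurement t (Inl (x, m)))"
    then have Sx: "measurement s (Inl (x, m)) = measurement t (Inl (x, m))"
      if "m \<in> M" "s \<in> S" "t \<in> S" for m s t using that by blast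
    \<comment> \<open>A generic point of \<open>S\<close> is taken because dependence of gradients
      is transferred only between generic points.\<close>
    obtain z where z: "z \<in> W" "generic_config z" "\<forall>k\<in>B. measurement z k = measurement q k"
      using fibre_contains_generic[OF Bq W(1,2)] by blast
    then have "z \<in> S" by (simp add: S_def)
    have Bz: "alg_independent_over_rat B (measurement z)"
      using Bq alg_independent_cong[of B "measurement z" "measurement q"] z(3) by blast
    \<comment> \<open>The realization fixed by the definition of the rank; \<open>P\<close>
      completes it generically outside \<open>V\<close>.\<close>
    define P0 :: "'v \<Rightarrow> real^'d" where "P0 = (SOME p. generic V p)"
    have "generic V (($) p)" using p by (rule generic_if_generic_config) simp
    then have "generic V P0" unfolding P0_def by (rule someI[where P="generic V"])
    then obtain P where P: "generic_config P" "\<forall>w\<in>V. P $ w = P0 w"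
      using ex_generic_config[OF _ zero_less_one] by blast
    let ?R = "rigidity_rows (E - {{x, y}}) P0"
    have BR: "gradient P ` B \<subseteq> span ?R"
    proof
      fix r assume "r \<in> gradient P ` B"
      then obtain a b where ab: "{a, b} \<in> E'" "r = gradient P (Inl (a, b))"
        using B(1) by (auto simp: D_def)
      then have "rigidity_row P0 a b \<in> ?R"
        unfolding rigidity_rows_def by (auto simp: E' doubleton_eq_iff)
      moreover have "r = 2 *\<^sub>R rigidity_row P0 a b"
        using ab edge[of a b] P(2) by (simp add: E' gradient_eq_rigidity_row)
      ultimately show "r \<in> span ?R" by (simp add: span_base span_scale)
    qed
    \<comment> \<open>If the distance of \<open>a\<close> and \<open>b\<close> is constant on
      \<open>S\<close>, its gradient depends on those of \<open>B\<close> at \<open>z\<close>, hence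
      also at \<open>P\<close>.\<close>
    have rigid: "rigidity_row P0 a b \<in> span ?R"
      if ab: "a \<in> V" "b \<in> V" and const: "\<And>s. s \<in> S \<Longrightarrow> measurement s (Inl (a, b)) = measurement z (Inl (a, b))"
      for a b
    proof -
      let ?e = "Inl (a, b) :: ('v \<times> 'v) + ('v \<times> 'd)"
      have "?e \<in> B \<or> \<not> indep_family (gradient z) (insert ?e B)"
      proof (rule ccontr)
        assume "\<not> ?thesis"
        then have e: "indep_family (gradient z) (insert ?e B)" "?e \<notin> B" by auto
        obtain s where s: "s \<in> W" "\<forall>k\<in>B. measurement s k = measurement z k"
          "measurement s ?e \<noteq> measurement z ?e"
          using measurement_nonconstant_on_fibre[OF W(1) z(1) e] by blast
        then have "s \<in> S" using z(3) by (simp add: S_def)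
        then show False using const s(3) by blast
      qed
      then have "gradient P ?e \<in> span (gradient P ` B)"
        by (rule gradient_in_span_transfer[OF z(2) P(1) Bz])
      then have "gradient P ?e \<in> span ?R"
        using BR by (meson span_minimal subspace_span subsetD)
      then have "(1/2) *\<^sub>R gradient P ?e \<in> span ?R" by (rule span_scale)
      moreover have "(1/2) *\<^sub>R gradient P ?e = rigidity_row P0 a b"
        using ab P(2) by (simp add: gradient_eq_rigidity_row)
      ultimately show ?thesis by simp
    qed
    have MV: "m \<in> V" if "m \<in> M" for m using N(4)[of m] M(1) that by (auto simp: V'_def)
    \<comment> \<open>The rows within the frame and from it to \<open>x\<close> come from constant
      distances, those to \<open>y\<close> from edges of \<open>G\<close> other than
      \<open>xy\<close>; together they force the row of \<open>xy\<close>.\<close>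
    have "rigidity_row P0 x y \<in> span ?R"
    proof (rule rigidity_row_in_span)
      show "affine_frame P0 n M"
        by (rule affine_frame_congruent[OF frame[OF P(1)]]) (use P(2) MV in simp)
      show "rigidity_row P0 m k \<in> span ?R" if "m \<in> M" "k \<in> M" for m k
        using MV[OF that(1)] MV[OF that(2)]
      proof (rule rigid)
        fix s assume s: "s \<in> S"
        have "m \<in> N" "k \<in> N" using that M(1) by auto
        from SN[OF s this] SN[OF \<open>z \<in> S\<close> this]
        show "measurement s (Inl (m, k)) = measurement z (Inl (m, k))"
          by (simp add: measurement_def)
      qed
      show "rigidity_row P0 x m \<in> span ?R" if "m \<in> M" for m
        using edge(1)[OF assms(3)] MV[OF that] by (rule rigid) (rule Sx[OF that _ \<open>z \<in> S\<close>])
      show "rigidity_row P0 y m \<in> span ?R" if "m \<in> M" for m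
      proof (rule span_base)
        have m: "m \<in> N" using that M(1) by blast
        have "{y, m} \<in> E - {{x, y}}"
          using N(1-3)[OF m] by (auto simp: doubleton_eq_iff)
        then show "rigidity_row P0 y m \<in> ?R" unfolding rigidity_rows_def by blast
      qed
    qed
    then show False
      using not_bridge_if_in_span[OF assms(3) P0_def] assms(4) by blast
  qed

  \<comment> \<open>Placing \<open>y\<close> by means of two positions of \<open>x\<close>\<close>
  then obtain m s t where m: "m \<in> M" and st: "s \<in> S" "t \<in> S"
    "measurement s (Inl (x, m)) \<noteq> measurement t (Inl (x, m))" by blast
  define \<delta> :: "real^'d^'v \<Rightarrow> 'v \<Rightarrow> real" where "\<delta> s m = (norm (s $ m - s $ x))\<^sup>2 - (norm (p $ m - p $ x))\<^sup>2" for s m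
  have \<delta>: "\<delta> s m = measurement s (Inl (m, x)) - measurement p (Inl (m, x))" for s m
    by (simp add: \<delta>_def measurement_def)
  have cont: "continuous_on S (\<lambda>s. \<delta> s m)" for m
    unfolding \<delta> by (intro continuous_on_diff continuous_on_measurement continuous_on_const)
  have "\<delta> s m \<noteq> \<delta> t m"
    using st(3) by (simp add: \<delta>_def measurement_def norm_minus_commute)
  \<comment> \<open>Distinct nonzero changes make \<open>p $ x\<close> and the two transported
    positions \<open>x0\<close> and \<open>x1\<close> pairwise different.\<close>
  then obtain s0 s1 where s01: "s0 \<in> S" "s1 \<in> S" "\<delta> s0 m \<noteq> 0" "\<delta> s1 m \<noteq> 0" "\<delta> s0 m \<noteq> \<delta> s1 m"
    using connected_two_nonzero_values[OF conn cont st(1,2)] by blast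

  have SM: "norm (p $ i - p $ j) = norm (s $ i - s $ j)" if "s \<in> S" "i \<in> M" "j \<in> M" for s i j
    using SN[OF that(1)] that(2,3) M(1) by blast
  \<comment> \<open>\<open>c\<close> is where an isometry taking the frame of \<open>s\<close> to
    that of \<open>p\<close> would send \<open>s $ x\<close>; it is found by reusing barycentric
    coordinates.\<close>
  have place: "\<exists>c. \<forall>i\<in>M. norm (p $ i - c) = norm (s $ i - s $ x)" if s: "s \<in> S" for s
  proof -
    have fs: "affine_frame (($) s) n M"
      by (rule affine_frame_congruent[OF frame[OF p] SM[OF s]])
    obtain l where l: "(\<Sum>i\<in>M. l i) = 1" "s $ x = (\<Sum>i\<in>M. l i *\<^sub>R s $ i)"
      using affine_frame_combination[OF fs, of "s $ x"] by blast
    have "norm ((\<Sum>i\<in>M. l i *\<^sub>R p $ i) - p $ j) = norm ((\<Sum>i\<in>M. l i *\<^sub>R s $ i) - s $ j)"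
      if "j \<in> M" for j
    proof (rule power2_eq_imp_eq)
      show "(norm ((\<Sum>i\<in>M. l i *\<^sub>R p $ i) - p $ j))\<^sup>2 = (norm ((\<Sum>i\<in>M. l i *\<^sub>R s $ i) - s $ j))\<^sup>2"
        unfolding barycentric_norm[OF l(1)] using SM[OF s] that by simp
    qed auto
    then show ?thesis
      by (intro exI[of _ "\<Sum>i\<in>M. l i *\<^sub>R p $ i"]) (simp add: l(2) norm_minus_commute)
  qed
  obtain x0 where x0: "\<forall>i\<in>M. norm (p $ i - x0) = norm (s0 $ i - s0 $ x)" using place[OF s01(1)] ..
  obtain x1 where x1: "\<forall>i\<in>M. norm (p $ i - x1) = norm (s1 $ i - s1 $ x)" using place[OF s01(2)] ..
  have "x0 \<noteq> p $ x" "x1 \<noteq> p $ x" "x0 \<noteq> x1"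
    using x0 x1 m s01(3-5) by (auto simp: \<delta>_def)
  from between_bisectors[OF this] obtain y0 where y0: "((norm (x0 - y0))\<^sup>2 - (norm (p $ x - y0))\<^sup>2) *
      ((norm (x1 - y0))\<^sup>2 - (norm (p $ x - y0))\<^sup>2) < 0" ..
  define O' where "O' = {y. ((norm (x0 - y))\<^sup>2 - (norm (p $ x - y))\<^sup>2) *
      ((norm (x1 - y))\<^sup>2 - (norm (p $ x - y))\<^sup>2) < 0}"
  have "open O'"
    unfolding O'_def by (intro open_Collect_less continuous_intros)
  moreover have "y0 \<in> O'" using y0 by (simp add: O'_def)
  ultimately obtain \<epsilon> where \<epsilon>: "0 < \<epsilon>" "ball y0 \<epsilon> \<subseteq> O'"
    using open_contains_ball by blast
  have "generic (- {y}) (($) p)" using p by (rule generic_if_generic_config) simp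
  then obtain P where P: "generic_config P" "\<forall>w\<in>- {y}. P $ w = p $ w" "norm (P $ y - y0) < \<epsilon>"
    using ex_generic_config[OF _ \<epsilon>(1), of "- {y}" "($) p" "\<lambda>_. y0"] by blast
  have Pp: "P $ w = p $ w" if "w \<noteq> y" for w using P(2) that by simp
  have Py: "P $ y \<in> O'"
    using \<epsilon>(2) P(3) by (auto simp: dist_norm norm_minus_commute)
  obtain l where l: "(\<Sum>i\<in>M. l i) = 1" "P $ y = (\<Sum>i\<in>M. l i *\<^sub>R p $ i)"
    using affine_frame_combination[OF frame[OF p], of "P $ y"] by blast
  \<comment> \<open>With the barycentric coordinates of \<open>y\<close> fixed, the pair terms
    cancel and the difference of squared distances is linear in \<open>\<delta>\<close>. This makes
    it continuous in \<open>s\<close> without any continuity of the transported points.\<close>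
  define \<phi> :: "real^'d^'v \<Rightarrow> real" where "\<phi> s = (\<Sum>i\<in>M. l i * \<delta> s i)" for s
  have \<phi>: "(norm (c - P $ y))\<^sup>2 - (norm (p $ x - P $ y))\<^sup>2 = \<phi> s"
    if "\<forall>i\<in>M. norm (p $ i - c) = norm (s $ i - s $ x)" for c s
  proof -
    have "(norm (c - P $ y))\<^sup>2 - (norm (p $ x - P $ y))\<^sup>2
        = (\<Sum>i\<in>M. l i * (norm (p $ i - c))\<^sup>2) - (\<Sum>i\<in>M. l i * (norm (p $ i - p $ x))\<^sup>2)"
      unfolding norm_minus_commute[of c] norm_minus_commute[of "p $ x"] l(2) barycentric_norm[OF l(1)]
      by simp
    then show ?thesis
      using that by (simp add: \<phi>_def \<delta>_def right_diff_distrib sum_subtractf)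
  qed
  have neg: "\<phi> s0 * \<phi> s1 < 0"
    using Py unfolding O'_def mem_Collect_eq \<phi>[OF x0] \<phi>[OF x1] .
  have "connected (\<phi> ` S)"
    unfolding \<phi>_def using conn
    by (intro connected_continuous_image continuous_on_sum continuous_on_mult continuous_on_const cont)
  moreover have "\<phi> s0 \<in> \<phi> ` S" "\<phi> s1 \<in> \<phi> ` S" using s01(1,2) by auto
  moreover have "\<phi> s0 \<le> 0 \<and> 0 \<le> \<phi> s1 \<or> \<phi> s1 \<le> 0 \<and> 0 \<le> \<phi> s0"
    using neg by (auto simp: mult_less_0_iff)
  ultimately have "0 \<in> \<phi> ` S"
    unfolding connected_iff_interval by blast
  then obtain s where s: "s \<in> S" "\<phi> s = 0" by auto

  \<comment> \<open>The equivalent realization of \<open>G\<close>\<close>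
  define Q where "Q w = (if w = y then \<Sum>i\<in>M. l i *\<^sub>R s $ i else s $ w)" for w
  \<comment> \<open>\<open>y\<close> keeps its barycentric coordinates, hence its distance to each
    neighbour whose distances to the frame are unchanged. For \<open>x\<close> these may change, and
    \<open>\<phi> s = 0\<close> says that the weighted changes cancel.\<close>
  have Qy: "norm (P $ y - P $ j) = norm (Q y - Q j)" if yj: "{y, j} \<in> E" for j
  proof -
    have j: "j \<noteq> y" using edge(3)[OF yj] by simp
    have "(norm (P $ y - P $ j))\<^sup>2 = (norm (Q y - Q j))\<^sup>2"
    proof (cases "j = x")
      case True
      have "(\<Sum>i\<in>M. l i * (norm (p $ i - p $ x))\<^sup>2) = (\<Sum>i\<in>M. l i * (norm (s $ i - s $ x))\<^sup>2)"
        using s(2) by (simp add: \<phi>_def \<delta>_def right_diff_distrib sum_subtractf)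
      then show ?thesis
        unfolding Q_def l(2) using j True
        by (simp add: Pp barycentric_norm[OF l(1)] SM[OF s(1)])
    next
      case False
      then have "j \<in> N" using yj by (simp add: N_def neighbours_def)
      then have "norm (p $ i - p $ j) = norm (s $ i - s $ j)" if "i \<in> M" for i
        using SN[OF s(1), of i j] that M(1) by blast
      then show ?thesis
        unfolding Q_def l(2) using j
        by (simp add: Pp barycentric_norm[OF l(1)] SM[OF s(1)])
    qed
    then show ?thesis by (simp add: power2_eq_iff_nonneg)
  qed
  have "equivalent_frameworks E (($) P) Q"
    unfolding equivalent_frameworks_def
  proof (intro allI impI)
    fix a b assume ab: "{a, b} \<in> E"
    then have ba: "{b, a} \<in> E" by (simp add: insert_commute)
    consider "a = y" | "b = y" | "a \<noteq> y" "b \<noteq> y" by blast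
    then show "norm (P $ a - P $ b) = norm (Q a - Q b)"
    proof cases
      case 1
      then show ?thesis using Qy ab by simp
    next
      case 2
      then show ?thesis using Qy[of a] ba by (simp add: norm_minus_commute)
    next
      case 3
      then show ?thesis using Sequiv[OF s(1), of a b] ab by (simp add: E' Q_def Pp)
    qed
  qed
  moreover have "norm (Q u - Q v) \<noteq> norm (P $ u - P $ v)"
    using s(1) W(3) assms(10) by (auto simp: S_def U_def measurement_def Q_def Pp)
  moreover have "generic V (($) P)" using P(1) by (rule generic_if_generic_config) simp
  ultimately show ?thesis
    unfolding globally_linked_def globally_linked_in_framework_def by blast
qed

end
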